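(* There exists a positive integer $t$ such that for every positive integer $g$ there is a constant $c>0$ (depending only on $g$ and $t$) with the following property: for every integer $n\geq 3$ there exists a semilinear graph $G$ of complexity $t$ such that the girth of $G$ is at least $g$, $G$ contains no independent set of size $n$, and $G$ has at least $c\,n\log\log n$ vertices.
   Context: A function $f:\mathbb{R}^{m}\to\mathbb{R}$ is linear if $f(\mathbf{x})=b+\sum_{i=1}^m a_i\mathbf{x}(i)$ for some reals $a_1,\dots,a_m,b$. A (finite, simple) graph $G$ is semilinear of complexity $t$ if $V(G)\subset\mathbb{R}^d$ for some positive integer $d$, and there are $t$ linear functions $f_1,\dots,f_t:\mathbb{R}^d\times\mathbb{R}^d\to\mathbb{R}$ and a Boolean function $\phi:\{\mathrm{F},\mathrm{T}\}^{3t}\to\{\mathrm{F},\mathrm{T}\}$ such that for distinct $\mathbf{x},\mathbf{y}\in V(G)$, $\{\mathbf{x},\mathbf{y}\}$ is an edge iff $\phi\big(\{f_i(\mathbf{x},\mathbf{y})<0,\ f_i(\mathbf{x},\mathbf{y})\leq 0,\ f_i(\mathbf{x},\mathbf{y})=0\}_{i\in[t]}\big)=\mathrm{T}$; it is assumed that this truth value is unchanged when $\mathbf{x}$ and $\mathbf{y}$ are swapped. The girth of a graph is the length of its shortest cycle (infinite if acyclic). *)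

theory Defs
  imports Complex_Main
begin

text \<open>Points of R^d are represented as real lists of length d; coordinate i is x ! i.
A linear function f : R^d x R^d -> R is given by (b, a, a') and evaluates to
b + sum_{i<d} a i * x(i) + sum_{i<d} a' i * y(i).\<close>

type_synonym linfun = "real \<times> (nat \<Rightarrow> real) \<times> (nat \<Rightarrow> real)"

definition lin_eval :: "nat \<Rightarrow> linfun \<Rightarrow> real list \<Rightarrow> real list \<Rightarrow> real" where
  "lin_eval d f x y =
     fst f + (\<Sum>i<d. fst (snd f) i * x ! i) + (\<Sum>i<d. snd (snd f) i * y ! i)"

definition sign_atoms :: "nat \<Rightarrow> linfun list \<Rightarrow> real list \<Rightarrow> real list \<Rightarrow> (bool \<times> bool \<times> bool) list" where
  "sign_atoms d fs x y =
     map (\<lambda>f. (lin_eval d f x y < 0, lin_eval d f x y \<le> 0, lin_eval d f x y = 0)) fs"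

definition simple_graph :: "'a set \<Rightarrow> ('a \<Rightarrow> 'a \<Rightarrow> bool) \<Rightarrow> bool" where
  "simple_graph V E \<longleftrightarrow> finite V \<and>
     (\<forall>x y. E x y \<longrightarrow> x \<in> V \<and> y \<in> V \<and> x \<noteq> y \<and> E y x)"

definition semilinear :: "nat \<Rightarrow> real list set \<Rightarrow> (real list \<Rightarrow> real list \<Rightarrow> bool) \<Rightarrow> bool" where
  "semilinear t V E \<longleftrightarrow> simple_graph V E \<and>
     (\<exists>d::nat. d \<ge> 1 \<and> (\<forall>x\<in>V. length x = d) \<and>
       (\<exists>(fs :: linfun list) (\<phi> :: (bool \<times> bool \<times> bool) list \<Rightarrow> bool).
          length fs = t \<and>
          (\<forall>x\<in>V. \<forall>y\<in>V. x \<noteq> y \<longrightarrow> (E x y \<longleftrightarrow> \<phi> (sign_atoms d fs x y)))))"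

definition is_cycle :: "'a set \<Rightarrow> ('a \<Rightarrow> 'a \<Rightarrow> bool) \<Rightarrow> 'a list \<Rightarrow> bool" where
  "is_cycle V E vs \<longleftrightarrow> length vs \<ge> 3 \<and> distinct vs \<and> set vs \<subseteq> V \<and>
     (\<forall>i < length vs. E (vs ! i) (vs ! ((i + 1) mod length vs)))"

text \<open>Girth at least g (vacuous if acyclic, i.e. girth infinite).\<close>
definition girth_ge :: "'a set \<Rightarrow> ('a \<Rightarrow> 'a \<Rightarrow> bool) \<Rightarrow> nat \<Rightarrow> bool" where
  "girth_ge V E g \<longleftrightarrow> (\<forall>vs. is_cycle V E vs \<longrightarrow> length vs \<ge> g)"

definition independent_set :: "'a set \<Rightarrow> ('a \<Rightarrow> 'a \<Rightarrow> bool) \<Rightarrow> 'a set \<Rightarrow> bool" where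
  "independent_set V E S \<longleftrightarrow> S \<subseteq> V \<and> (\<forall>x\<in>S. \<forall>y\<in>S. \<not> E x y)"

end

theory Submission
  imports Defs "HOL-Library.FuncSet"
begin

text \<open>Vertices are labels (i, a) with i < L and a < n, placed by a random map p into the cube
  {0..<b}^L; for i < j the vertices (i, a) and (j, c) are adjacent if their points differ at most
  in coordinate i.

  If S is independent, let U i be the union of the lines of direction i through the points of S
  of type i. The points of S of type i lie in W i = U i - (\<Union>j<i. U j), and the sets W i are
  disjoint. There are at most 2 ^ (b ^ (L - 1)) choices for each U i, and by AM-GM a fixed choice
  is respected with probability at most (n / s) ^ s, where s is the size of S. With
  8 n = b ^ (L - 1), L = K 2 ^ (10 K) and s = L n / K, a union bound over S and U shows that such
  S rarely exist.

  Short cycles are destroyed by deleting few vertices. A cycle all of whose edges have the same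
  direction i contains two points of type i on one line of direction i. Any other cycle has a
  vertex where its direction changes; this vertex is determined by its two neighbours and the two
  directions, so such short cycles are rarer than vertices by a factor of order b.

  The graph has at most exp (exp (O(K))) vertices, and suitably many disjoint copies of it
  give the theorem for every n.\<close>

subsection \<open>Lines in the cube\<close>

definition cube :: "nat \<Rightarrow> nat \<Rightarrow> (nat \<Rightarrow> nat) set" where
  "cube b L = PiE {..<L} (\<lambda>_. {..<b})"

definition same_line :: "nat \<Rightarrow> nat \<Rightarrow> (nat \<Rightarrow> nat) \<Rightarrow> (nat \<Rightarrow> nat) \<Rightarrow> bool" where
  "same_line L i w w' \<longleftrightarrow> (\<forall>c<L. c \<noteq> i \<longrightarrow> w c = w' c)"

lemma finite_cube [simp]: "finite (cube b L)"
  by (simp add: cube_def finite_PiE)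

lemma card_cube: "card (cube b L) = b ^ L"
  by (simp add: cube_def card_PiE)

lemma cube_less: "w \<in> cube b L \<Longrightarrow> c < L \<Longrightarrow> w c < b"
  by (auto simp: cube_def PiE_iff)

lemma same_line_refl [simp]: "same_line L i w w"
  by (simp add: same_line_def)

lemma same_line_sym: "same_line L i w w' \<Longrightarrow> same_line L i w' w"
  by (simp add: same_line_def)

lemma same_line_trans: "same_line L i u v \<Longrightarrow> same_line L i v w \<Longrightarrow> same_line L i u w"
  by (simp add: same_line_def)

lemma cube_eqI:
  assumes "w \<in> cube b L" "w' \<in> cube b L" "\<And>c. c < L \<Longrightarrow> w c = w' c"
  shows "w = w'"
  using assms unfolding cube_def by (intro PiE_ext) auto

lemma card_line_le:
  assumes "i < L"
  shows "card {w \<in> cube b L. same_line L i w v} \<le> b"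
proof -
  have "inj_on (\<lambda>w. w i) {w \<in> cube b L. same_line L i w v}"
  proof (rule inj_onI, clarify)
    fix w w' assume *: "w \<in> cube b L" "w' \<in> cube b L"
      "same_line L i w v" "same_line L i w' v" "w i = w' i"
    show "w = w'"
      by (rule cube_eqI[OF *(1,2)]) (use * in \<open>metis same_line_def\<close>)
  qed
  then have "card {w \<in> cube b L. same_line L i w v} \<le> card {..<b}"
    by (rule card_inj_on_le) (use assms cube_less in auto)
  then show ?thesis by simp
qed

text \<open>No coordinate is exempt from both conditions, so the two lines together fix every
  coordinate.\<close>

lemma card_two_lines_le:
  assumes "i \<noteq> j"
  shows "card {w \<in> cube b L. same_line L i w u \<and> same_line L j w v} \<le> 1"
proof -
  have "w = w'" if "w \<in> cube b L" "w' \<in> cube b L" "same_line L i w u" "same_line L i w' u"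
      "same_line L j w v" "same_line L j w' v" for w w'
    by (rule cube_eqI[OF that(1,2)]) (use that assms in \<open>metis same_line_def\<close>)
  then show ?thesis
    by (intro card_le_Suc0_iff_eq[THEN iffD2, unfolded One_nat_def[symmetric]]) auto
qed

text \<open>A union of lines of direction \<open>i\<close> is determined by its trace on the
  hyperplane \<open>w i = 0\<close>, since every such line meets that hyperplane. The hyperplane has
  \<open>b ^ (L - 1)\<close> points.\<close>

lemma card_closed_sets_le:
  assumes "i < L" "0 < b"
  shows "card {U. U \<subseteq> cube b L \<and> (\<forall>w\<in>U. \<forall>w'\<in>cube b L. same_line L i w w' \<longrightarrow> w' \<in> U)}
           \<le> 2 ^ (b ^ (L - 1))" (is "card ?C \<le> _")
proof -
  define Z where "Z = {w \<in> cube b L. w i = 0}"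
  have upd: "w(i := 0) \<in> cube b L" "same_line L i w (w(i := 0))" if "w \<in> cube b L" for w
    using that assms by (auto simp: cube_def same_line_def PiE_iff extensional_def)
  have "Z \<subseteq> PiE {..<L} (\<lambda>c. if c = i then {0} else {..<b})"
    by (fastforce simp: Z_def cube_def PiE_iff extensional_def)
  then have "card Z \<le> card (PiE {..<L} (\<lambda>c. if c = i then {0} else {..<b}))"
    by (intro card_mono finite_PiE) auto
  also have "\<dots> = (\<Prod>c<L. if c = i then 1 else b)"
    by (simp add: card_PiE) (rule prod.cong, auto)
  also have "\<dots> = (\<Prod>c\<in>{..<L} - {i}. b)"
    using assms by (subst prod.remove[of _ i]) (auto intro: prod.cong)
  also have "\<dots> = b ^ (L - 1)"
    using assms by simp
  finally have Z: "card Z \<le> b ^ (L - 1)" .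
  have finZ: "finite Z" by (simp add: Z_def)
  have "inj_on (\<lambda>U. U \<inter> Z) ?C"
  proof (rule inj_onI)
    have sub: "U \<subseteq> U'" if "U \<in> ?C" "U' \<in> ?C" "U \<inter> Z = U' \<inter> Z" for U U'
    proof
      fix w assume w: "w \<in> U"
      then have wc: "w \<in> cube b L" using that by auto
      have "w(i := 0) \<in> U" using that(1) w upd[OF wc] by auto
      moreover have "w(i := 0) \<in> Z" using upd(1)[OF wc] by (simp add: Z_def)
      ultimately have "w(i := 0) \<in> U'" using that(3) by blast
      then show "w \<in> U'" using that(2) wc same_line_sym[OF upd(2)[OF wc]] by blast
    qed
    show "U = U'" if "U \<in> ?C" "U' \<in> ?C" "U \<inter> Z = U' \<inter> Z" for U U'
      using sub[of U U'] sub[of U' U] that by blast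
  qed
  then have "card ?C \<le> card (Pow Z)"
    by (rule card_inj_on_le) (use finZ in auto)
  also have "\<dots> \<le> 2 ^ (b ^ (L - 1))"
    using finZ Z by (simp add: card_Pow)
  finally show ?thesis .
qed

section \<open>Counting maps with prescribed values\<close>

lemma card_PiE_restrict:
  assumes "finite X" "S \<subseteq> X" "\<And>v. v \<in> S \<Longrightarrow> W v \<subseteq> Q"
  shows "card {p \<in> PiE X (\<lambda>_. Q). \<forall>v\<in>S. p v \<in> W v}
           = (\<Prod>v\<in>S. card (W v)) * card Q ^ (card X - card S)"
proof -
  have "{p \<in> PiE X (\<lambda>_. Q). \<forall>v\<in>S. p v \<in> W v} = PiE X (\<lambda>v. if v \<in> S then W v else Q)"
    using assms by (fastforce simp: PiE_iff split: if_splits)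
  then have "card {p \<in> PiE X (\<lambda>_. Q). \<forall>v\<in>S. p v \<in> W v}
      = (\<Prod>v\<in>X. card (if v \<in> S then W v else Q))"
    using assms by (simp add: card_PiE)
  also have "\<dots> = (\<Prod>v\<in>S. card (W v)) * (\<Prod>v\<in>X - S. card Q)"
    using assms prod.subset_diff[of S X "\<lambda>v. card (if v \<in> S then W v else Q)"]
    by (simp add: mult.commute)
  finally show ?thesis
    using assms by (simp add: card_Diff_subset finite_subset)
qed

text \<open>Union bound over the patterns in \<open>T\<close>. Distinctness of \<open>vs\<close>
  means that each pattern fixes exactly \<open>length vs\<close> values of the map.\<close>

lemma card_PiE_map_le:
  assumes "finite X" "finite T" "distinct vs" "set vs \<subseteq> X"
  shows "card {p \<in> PiE X (\<lambda>_. Q). map p vs \<in> T} \<le> card T * card Q ^ (card X - length vs)"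
proof -
  let ?F = "\<lambda>t. {p \<in> PiE X (\<lambda>_. Q). map p vs = t}"
  have *: "card (?F t) \<le> card Q ^ (card X - length vs)" for t
  proof (cases "?F t = {}")
    case False
    then obtain p where p: "p \<in> PiE X (\<lambda>_. Q)" "map p vs = t" by blast
    have "?F t = {q \<in> PiE X (\<lambda>_. Q). \<forall>v\<in>set vs. q v \<in> {p v}}"
      using p by (auto simp: map_eq_conv)
    then have "card (?F t) = (\<Prod>v\<in>set vs. card {p v}) * card Q ^ (card X - card (set vs))"
      using assms p(1) by (simp only:, intro card_PiE_restrict) auto
    then show ?thesis using assms by (simp add: distinct_card)
  next
    case True
    then show ?thesis by (metis card.empty zero_le)
  qed
  have "{p \<in> PiE X (\<lambda>_. Q). map p vs \<in> T} = (\<Union>t\<in>T. ?F t)" by auto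
  then have "card {p \<in> PiE X (\<lambda>_. Q). map p vs \<in> T} \<le> (\<Sum>t\<in>T. card (?F t))"
    using card_UN_le[OF assms(2)] by simp
  also have "\<dots> \<le> (\<Sum>t\<in>T. card Q ^ (card X - length vs))"
    by (intro sum_mono *)
  finally show ?thesis by simp
qed

section \<open>The random graph\<close>

definition sample_arc :: "nat \<Rightarrow> (nat \<times> nat \<Rightarrow> nat \<Rightarrow> nat) \<Rightarrow> nat \<times> nat \<Rightarrow> nat \<times> nat \<Rightarrow> bool" where
  "sample_arc L p u v \<longleftrightarrow> fst u < fst v \<and> same_line L (fst u) (p u) (p v)"

definition sample_edge :: "nat \<Rightarrow> (nat \<times> nat \<Rightarrow> nat \<Rightarrow> nat) \<Rightarrow> nat \<times> nat \<Rightarrow> nat \<times> nat \<Rightarrow> bool" where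
  "sample_edge L p u v \<longleftrightarrow> sample_arc L p u v \<or> sample_arc L p v u"

text \<open>This is the uniform probability space; probabilities and expectations appear below as
  cardinalities and sums over it.\<close>

definition samples :: "nat \<Rightarrow> nat \<Rightarrow> nat \<Rightarrow> (nat \<times> nat \<Rightarrow> nat \<Rightarrow> nat) set" where
  "samples b L n = PiE ({..<L} \<times> {..<n}) (\<lambda>_. cube b L)"

lemma finite_samples [simp]: "finite (samples b L n)"
  by (simp add: samples_def finite_PiE)

lemma card_samples: "card (samples b L n) = (b ^ L) ^ (L * n)"
  by (simp add: samples_def card_PiE card_cube)

text \<open>AM-GM, via t x \<le> exp (t x - 1).\<close>

lemma prod_weights_le:
  fixes \<omega> :: "nat \<Rightarrow> real"
  assumes S: "S \<subseteq> {..<L} \<times> {..<n}" and "S \<noteq> {}"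
    and pos: "\<And>i. 0 \<le> \<omega> i" and sum: "(\<Sum>i<L. \<omega> i) \<le> 1"
  shows "(\<Prod>v\<in>S. \<omega> (fst v)) \<le> (real n / real (card S)) ^ card S"
proof -
  have fin: "finite S" using S finite_subset by blast
  then have s: "0 < card S" using assms by (simp add: card_gt_0_iff)
  have n: "0 < n" using S \<open>S \<noteq> {}\<close> by (cases n) auto
  \<comment> \<open>This scaling brings the average of \<open>t * \<omega> (fst v)\<close> over
    \<open>S\<close> to at most 1, so that the exponents \<open>t * \<omega> (fst v) - 1\<close>
    have sum at most 0.\<close>
  define t where "t = real (card S) / real n"
  have t: "0 < t" using s n by (simp add: t_def)
  have "(\<Sum>v\<in>S. \<omega> (fst v)) \<le> (\<Sum>v\<in>{..<L} \<times> {..<n}. \<omega> (fst v))"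
    using S pos by (intro sum_mono2) auto
  also have "\<dots> = (\<Sum>i<L. \<Sum>a<n. \<omega> i)"
    by (simp only: sum.cartesian_product case_prod_unfold)
  also have "\<dots> = real n * (\<Sum>i<L. \<omega> i)"
    by (simp add: sum_distrib_left)
  also have "\<dots> \<le> real n" using mult_left_mono[OF sum, of "real n"] by simp
  finally have "t * (\<Sum>v\<in>S. \<omega> (fst v)) \<le> t * real n" using t by (simp add: mult_left_mono)
  then have le: "t * (\<Sum>v\<in>S. \<omega> (fst v)) \<le> real (card S)" using n by (simp add: t_def)
  have "t ^ card S * (\<Prod>v\<in>S. \<omega> (fst v)) = (\<Prod>v\<in>S. t * \<omega> (fst v))"
    by (simp add: prod.distrib)
  also have "\<dots> \<le> (\<Prod>v\<in>S. exp (t * \<omega> (fst v) - 1))"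
    using t pos exp_ge_add_one_self[of "t * \<omega> _ - 1"] by (intro prod_mono) auto
  also have "\<dots> = exp (t * (\<Sum>v\<in>S. \<omega> (fst v)) - real (card S))"
    by (simp add: exp_sum[OF fin, symmetric] sum_subtractf sum_distrib_left)
  also have "\<dots> \<le> 1" using le by simp
  finally have "(\<Prod>v\<in>S. \<omega> (fst v)) \<le> 1 / t ^ card S"
    using t by (simp add: field_simps)
  then show ?thesis by (simp add: t_def power_divide)
qed

subsection \<open>Sampling points of the cube\<close>

text \<open>The factors are the number of sets \<open>S\<close>, the number of families
  \<open>U\<close> of unions of lines, and the probability that the points of a fixed
  \<open>S\<close> fall into the cells given by a fixed \<open>U\<close>. The cells are disjoint, so
  their densities sum to at most 1 and \<open>prod_weights_le\<close> applies.\<close>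

lemma card_independent_samples_le:
  assumes "0 < b" "0 < s"
  shows "real (card {p \<in> samples b L n. \<exists>S \<subseteq> {..<L} \<times> {..<n}. card S = s \<and>
            (\<forall>u\<in>S. \<forall>v\<in>S. \<not> sample_arc L p u v)})
      \<le> 2 ^ (L * n) * (2 ^ (b ^ (L - 1))) ^ L * (real n / real s) ^ s * real (card (samples b L n))"
    (is "real (card ?Bad) \<le> _")
proof -
  define X where "X = {..<L} \<times> {..<n}"
  define C where "C = (\<lambda>i. {U. U \<subseteq> cube b L \<and>
    (\<forall>w\<in>U. \<forall>w'\<in>cube b L. same_line L i w w' \<longrightarrow> w' \<in> U)})"
  \<comment> \<open>Only lines of smaller direction are removed: arcs run from the smaller type to
    the larger and follow the direction of the smaller type.\<close>
  define W where "W = (\<lambda>(U :: nat \<Rightarrow> (nat \<Rightarrow> nat) set) i. U i - (\<Union>j<i. U j))"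
  define F where "F = (\<lambda>S U. {p \<in> samples b L n. \<forall>v\<in>S. p v \<in> W U (fst v)})"
  define \<S> where "\<S> = {S. S \<subseteq> X \<and> card S = s}"
  define M where "M = (real n / real s) ^ s * real (card (samples b L n))"
  have finX: "finite X" "card X = L * n" by (auto simp: X_def)
  have finS: "finite \<S>" by (simp add: \<S>_def finX)
  have finC: "finite (C i)" for i by (simp add: C_def)
  have finP: "finite (PiE {..<L} C)" using finC by (simp add: finite_PiE)
  have "card \<S> \<le> card (Pow X)"
    using finX by (intro card_mono) (auto simp: \<S>_def)
  then have cS: "card \<S> \<le> 2 ^ (L * n)" using finX by (simp add: card_Pow)
  have "card (PiE {..<L} C) = (\<Prod>i<L. card (C i))" by (simp add: card_PiE)
  also have "\<dots> \<le> (\<Prod>i<L. 2 ^ (b ^ (L - 1)))"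
    using card_closed_sets_le[OF _ assms(1)] by (intro prod_mono) (auto simp: C_def)
  finally have cP: "card (PiE {..<L} C) \<le> (2 ^ (b ^ (L - 1))) ^ L" by simp
  have F_le: "real (card (F S U)) \<le> M" if "S \<in> \<S>" "U \<in> PiE {..<L} C" for S U
  proof -
    have S: "S \<subseteq> X" "card S = s" using that by (auto simp: \<S>_def)
    have finS': "finite S" using S finX finite_subset by blast
    have U: "U i \<subseteq> cube b L" if "i < L" for i
      using that \<open>U \<in> PiE {..<L} C\<close> by (auto simp: C_def PiE_iff)
    then have WU: "W U i \<subseteq> cube b L" if "i < L" for i using that by (auto simp: W_def)
    define \<omega> where "\<omega> = (\<lambda>i. real (card (W U i)) / real (b ^ L))"
    have disj: "W U i \<inter> W U j = {}" if "i \<noteq> j" for i j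
      using that by (cases i j rule: linorder_cases) (auto simp: W_def)
    have "(\<Sum>i<L. card (W U i)) = card (\<Union>i<L. W U i)"
      using WU finite_subset[OF WU finite_cube] disj by (intro card_UN_disjoint[symmetric]) auto
    also have "\<dots> \<le> card (cube b L)"
      using WU by (intro card_mono) auto
    finally have "(\<Sum>i<L. card (W U i)) \<le> b ^ L" by (simp add: card_cube)
    then have "real (\<Sum>i<L. card (W U i)) \<le> real (b ^ L)" by (rule of_nat_mono)
    then have "(\<Sum>i<L. \<omega> i) \<le> 1"
      using assms by (simp add: \<omega>_def flip: sum_divide_distrib)
    moreover have "S \<noteq> {}" using S assms(2) by auto
    ultimately have prod: "(\<Prod>v\<in>S. \<omega> (fst v)) \<le> (real n / real s) ^ s"
      using prod_weights_le[of S L n \<omega>] S by (simp add: X_def \<omega>_def)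
    have sle: "s \<le> L * n" using card_mono[OF finX(1) S(1)] S finX by simp
    have WS: "W U (fst v) \<subseteq> cube b L" if "v \<in> S" for v
    proof -
      have "fst v < L" using that S(1) by (auto simp: X_def)
      then show ?thesis by (rule WU)
    qed
    have "card (F S U) = (\<Prod>v\<in>S. card (W U (fst v))) * card (cube b L) ^ (card X - card S)"
      unfolding F_def samples_def X_def[symmetric]
      by (rule card_PiE_restrict[where W = "\<lambda>v. W U (fst v)", OF finX(1) S(1) WS])
    then have "real (card (F S U)) = (\<Prod>v\<in>S. real (card (W U (fst v)))) * real (b ^ L) ^ (L * n - s)"
      by (simp only: of_nat_mult of_nat_power of_nat_prod card_cube finX S)
    \<comment> \<open>Passing from cardinalities to densities extracts a factor
      \<open>(b ^ L) ^ s\<close>, which completes \<open>(b ^ L) ^ (L * n - s)\<close> to the number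
      of all samples.\<close>
    also have "(\<Prod>v\<in>S. real (card (W U (fst v)))) = (\<Prod>v\<in>S. \<omega> (fst v)) * real (b ^ L) ^ s"
      using assms by (simp add: \<omega>_def prod_dividef S(2))
    also have "(\<Prod>v\<in>S. \<omega> (fst v)) * real (b ^ L) ^ s * real (b ^ L) ^ (L * n - s)
        = (\<Prod>v\<in>S. \<omega> (fst v)) * real (card (samples b L n))"
      using sle by (simp only: card_samples of_nat_power mult.assoc power_add[symmetric]) simp
    also have "\<dots> \<le> M"
      unfolding M_def by (intro mult_right_mono prod) auto
    finally show ?thesis .
  qed
  have "?Bad \<subseteq> (\<Union>S\<in>\<S>. \<Union>U\<in>PiE {..<L} C. F S U)"
  proof
    fix p assume "p \<in> ?Bad"
    then obtain S where p: "p \<in> samples b L n" and S: "S \<subseteq> X" "card S = s"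
      and ind: "\<And>u v. u \<in> S \<Longrightarrow> v \<in> S \<Longrightarrow> \<not> sample_arc L p u v"
      by (auto simp: X_def)
    \<comment> \<open>The witness for \<open>p\<close>: all lines of direction \<open>i\<close>
      through the points of \<open>S\<close> of type \<open>i\<close>.\<close>
    define U where "U = (\<lambda>i\<in>{..<L}. {w \<in> cube b L. \<exists>a. (i, a) \<in> S \<and> same_line L i (p (i, a)) w})"
    have "U \<in> PiE {..<L} C"
      by (auto simp: U_def C_def intro: same_line_trans)
    moreover have "p v \<in> W U (fst v)" if v: "v \<in> S" for v
    proof -
      obtain i a where ia: "v = (i, a)" by (cases v)
      have i: "i < L" and pv: "p v \<in> cube b L"
        using v S p by (auto simp: ia X_def samples_def PiE_iff)
      have "p v \<in> U i" using i pv v by (auto simp: U_def ia intro!: exI[of _ a])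
      \<comment> \<open>Otherwise some vertex of \<open>S\<close> of type \<open>j < i\<close> would
        have an arc to \<open>v\<close>.\<close>
      moreover have "p v \<notin> U j" if "j < i" for j
        using that i ind[OF _ v] by (auto simp: U_def sample_arc_def ia)
      ultimately show ?thesis by (auto simp: W_def ia)
    qed
    then have "p \<in> F S U" using p by (simp add: F_def)
    moreover have "S \<in> \<S>" using S by (simp add: \<S>_def)
    ultimately show "p \<in> (\<Union>S\<in>\<S>. \<Union>U\<in>PiE {..<L} C. F S U)"
      by blast
  qed
  then have "card ?Bad \<le> card (\<Union>S\<in>\<S>. \<Union>U\<in>PiE {..<L} C. F S U)"
    by (rule card_mono[rotated]) (intro finite_UN_I finS finP, simp add: F_def)
  also have "\<dots> \<le> (\<Sum>S\<in>\<S>. card (\<Union>U\<in>PiE {..<L} C. F S U))"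
    by (rule card_UN_le[OF finS])
  also have "\<dots> \<le> (\<Sum>S\<in>\<S>. \<Sum>U\<in>PiE {..<L} C. card (F S U))"
    by (intro sum_mono card_UN_le[OF finP])
  finally have "real (card ?Bad) \<le> (\<Sum>S\<in>\<S>. \<Sum>U\<in>PiE {..<L} C. real (card (F S U)))"
    by (simp only: of_nat_sum[symmetric] of_nat_le_iff)
  also have "\<dots> \<le> (\<Sum>S\<in>\<S>. \<Sum>U\<in>PiE {..<L} C. M)"
    by (intro sum_mono F_le)
  also have "\<dots> = real (card \<S>) * real (card (PiE {..<L} C)) * M" by simp
  also have "\<dots> \<le> 2 ^ (L * n) * (2 ^ (b ^ (L - 1))) ^ L * M"
    using of_nat_mono[OF cS, where ?'a = real] of_nat_mono[OF cP, where ?'a = real]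
    by (intro mult_right_mono mult_mono) (auto simp: M_def)
  finally show ?thesis by (simp add: M_def mult.assoc)
qed

section \<open>Walks along lines, and closed walks with a bend\<close>

definition walks :: "nat \<Rightarrow> nat \<Rightarrow> nat \<Rightarrow> (nat \<Rightarrow> nat) list set" where
  "walks b L r = {zs. length zs = Suc r \<and> set zs \<subseteq> cube b L \<and>
     (\<forall>i<r. \<exists>d<L. same_line L d (zs ! i) (zs ! Suc i))}"

lemma finite_walks [simp]: "finite (walks b L r)"
  by (rule finite_subset[OF _ finite_lists_length_eq[OF finite_cube, of b L "Suc r"]])
    (auto simp: walks_def)

text \<open>A walk is extended at its head by choosing one of \<open>L\<close> directions and one of
  at most \<open>b\<close> points on that line.\<close>

lemma card_walks_le: "card (walks b L r) \<le> b ^ L * (L * b) ^ r"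
proof (induction r)
  case 0
  have "walks b L 0 \<subseteq> (\<lambda>w. [w]) ` cube b L"
    by (auto simp: walks_def length_Suc_conv)
  then have "card (walks b L 0) \<le> card (cube b L)" by (rule surj_card_le[rotated]) simp
  then show ?case by (simp add: card_cube)
next
  case (Suc r)
  let ?N = "\<lambda>zs d. (\<lambda>w. w # zs) ` {w \<in> cube b L. same_line L d w (hd zs)}"
  have "walks b L (Suc r) \<subseteq> (\<Union>zs\<in>walks b L r. \<Union>d<L. ?N zs d)"
  proof
    fix vs assume vs: "vs \<in> walks b L (Suc r)"
    then obtain w zs where ws: "vs = w # zs" "length zs = Suc r"
      by (auto simp: walks_def length_Suc_conv)
    have "zs \<in> walks b L r" using vs ws by (fastforce simp: walks_def)
    moreover have "\<exists>d<L. same_line L d w (hd zs)"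
      using vs ws by (cases zs) (fastforce simp: walks_def)+
    moreover have "w \<in> cube b L" using vs ws by (auto simp: walks_def)
    ultimately show "vs \<in> (\<Union>zs\<in>walks b L r. \<Union>d<L. ?N zs d)" using ws by auto
  qed
  then have "card (walks b L (Suc r)) \<le> card (\<Union>zs\<in>walks b L r. \<Union>d<L. ?N zs d)"
    by (rule card_mono[rotated]) auto
  also have "\<dots> \<le> (\<Sum>zs\<in>walks b L r. card (\<Union>d<L. ?N zs d))"
    by (rule card_UN_le) simp
  also have "\<dots> \<le> (\<Sum>zs\<in>walks b L r. \<Sum>d<L. card (?N zs d))"
    by (intro sum_mono card_UN_le) simp
  also have "\<dots> \<le> (\<Sum>zs\<in>walks b L r. \<Sum>d<L. b)"
  proof (intro sum_mono)
    fix zs d assume "d \<in> {..<L}"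
    then have "card {w \<in> cube b L. same_line L d w (hd zs)} \<le> b"
      by (intro card_line_le) simp
    then show "card (?N zs d) \<le> b"
      using card_image_le[of "{w \<in> cube b L. same_line L d w (hd zs)}" "\<lambda>w. w # zs"] by simp
  qed
  also have "\<dots> = card (walks b L r) * (L * b)" by simp
  also have "\<dots> \<le> b ^ L * (L * b) ^ r * (L * b)" by (intro mult_right_mono Suc.IH) simp
  finally show ?case by (simp add: mult_ac)
qed

text \<open>A closed walk cut open at a bend: \<open>y\<close> is the point where the direction
  changes, and \<open>zs\<close> leads from one neighbour of \<open>y\<close> round to the
  other.\<close>

definition bent_walks :: "nat \<Rightarrow> nat \<Rightarrow> nat \<Rightarrow> (nat \<Rightarrow> nat) list set" where
  "bent_walks b L r = {y # zs | y zs. y \<in> cube b L \<and> zs \<in> walks b L r \<and>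
     (\<exists>d<L. \<exists>d'<L. d \<noteq> d' \<and> same_line L d y (hd zs) \<and> same_line L d' y (last zs))}"

lemma bent_walks_subset:
  "bent_walks b L r \<subseteq> (\<Union>zs\<in>walks b L r. \<Union>(d, d')\<in>{(d, d'). d < L \<and> d' < L \<and> d \<noteq> d'}.
      (\<lambda>y. y # zs) ` {y \<in> cube b L. same_line L d y (hd zs) \<and> same_line L d' y (last zs)})"
  by (fastforce simp: bent_walks_def)

lemma finite_bent_walks [simp]: "finite (bent_walks b L r)"
proof -
  have "finite {(d, d'). d < L \<and> d' < L \<and> d \<noteq> d'}"
    by (rule finite_subset[of _ "{..<L} \<times> {..<L}"]) auto
  then show ?thesis by (intro finite_subset[OF bent_walks_subset]) auto
qed

text \<open>Two lines of different directions meet in at most one point, so closing up a walk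
  at a bend costs a factor b compared with an arbitrary extension.\<close>

lemma card_bent_walks_le: "card (bent_walks b L r) \<le> b ^ L * (L * b) ^ r * L\<^sup>2"
proof -
  let ?D = "{(d, d'). d < L \<and> d' < L \<and> d \<noteq> d'}"
  let ?A = "\<lambda>zs dd. {y \<in> cube b L. same_line L (fst dd) y (hd zs) \<and> same_line L (snd dd) y (last zs)}"
  have D: "?D \<subseteq> {..<L} \<times> {..<L}" by auto
  then have finD: "finite ?D" by (rule finite_subset) simp
  have cD: "card ?D \<le> L\<^sup>2" using card_mono[OF _ D] by (simp add: power2_eq_square)
  have "card (bent_walks b L r) \<le> card (\<Union>zs\<in>walks b L r. \<Union>dd\<in>?D. (\<lambda>y. y # zs) ` ?A zs dd)"
    using bent_walks_subset finD by (intro card_mono) (auto simp: case_prod_unfold)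
  also have "\<dots> \<le> (\<Sum>zs\<in>walks b L r. card (\<Union>dd\<in>?D. (\<lambda>y. y # zs) ` ?A zs dd))"
    by (rule card_UN_le) simp
  also have "\<dots> \<le> (\<Sum>zs\<in>walks b L r. \<Sum>dd\<in>?D. card ((\<lambda>y. y # zs) ` ?A zs dd))"
    by (intro sum_mono card_UN_le finD)
  also have "\<dots> \<le> (\<Sum>zs\<in>walks b L r. \<Sum>dd\<in>?D. 1)"
  proof (intro sum_mono)
    fix zs dd assume "dd \<in> ?D"
    then have "card (?A zs dd) \<le> 1" by (intro card_two_lines_le) auto
    then show "card ((\<lambda>y. y # zs) ` ?A zs dd) \<le> 1"
      using card_image_le[of "?A zs dd" "\<lambda>y. y # zs"] by simp
  qed
  also have "\<dots> = card (walks b L r) * card ?D" by simp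
  also have "\<dots> \<le> b ^ L * (L * b) ^ r * L\<^sup>2" by (intro mult_mono card_walks_le cD) auto
  finally show ?thesis .
qed

section \<open>Expected number of deleted vertices\<close>

text \<open>First moment bound by exchanging sums. The elements of \<open>C\<close> are
  certificates, and \<open>h\<close> reads off the vertex that a certificate condemns; several
  certificates for one vertex only overcount.\<close>

lemma sum_card_le_double_count:
  assumes "finite P" "finite C" "\<And>p. p \<in> P \<Longrightarrow> B p \<subseteq> h ` {c \<in> C. R p c}"
  shows "(\<Sum>p\<in>P. card (B p)) \<le> (\<Sum>c\<in>C. card {p \<in> P. R p c})"
proof -
  have "(\<Sum>p\<in>P. card (B p)) \<le> (\<Sum>p\<in>P. card {c \<in> C. R p c})"
    using assms(2) surj_card_le[OF _ assms(3)] by (intro sum_mono) simp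
  also have "\<dots> = (\<Sum>c\<in>C. card {p \<in> P. R p c})"
    using sum.swap_restrict[OF assms(1,2), of "\<lambda>_ _. 1 :: nat" R] by simp
  finally show ?thesis .
qed

text \<open>Once these vertices are deleted, every line of direction \<open>i\<close> carries at
  most one vertex of type \<open>i\<close>.\<close>

definition crowded :: "nat \<Rightarrow> nat \<Rightarrow> (nat \<times> nat \<Rightarrow> nat \<Rightarrow> nat) \<Rightarrow> (nat \<times> nat) set" where
  "crowded L n p = {v \<in> {..<L} \<times> {..<n}. \<exists>v' \<in> {..<L} \<times> {..<n}.
     v' \<noteq> v \<and> fst v' = fst v \<and> same_line L (fst v) (p v) (p v')}"

text \<open>A line is a fraction \<open>1 / b ^ (L - 1)\<close>, that is \<open>1 / (8 * n)\<close>,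
  of the cube, and a vertex has fewer than \<open>n\<close> possible partners of its type. So it is
  crowded with probability at most 1/8.\<close>

lemma sum_card_crowded_le:
  assumes "b ^ (L - 1) = 8 * n" "0 < n" "0 < L"
  shows "8 * (\<Sum>p\<in>samples b L n. card (crowded L n p)) \<le> L * n * card (samples b L n)"
proof -
  define X where "X = {..<L} \<times> {..<n}"
  define C where "C = {c \<in> X \<times> X. snd c \<noteq> fst c \<and> fst (snd c) = fst (fst c)}"
  have X: "finite X" "card X = L * n" by (simp_all add: X_def)
  have finC: "finite C" by (simp add: C_def X)
  have "C \<subseteq> (\<lambda>(v, a). (v, (fst v, a))) ` (X \<times> {..<n})"
    by (force simp: C_def X_def)
  then have "card C \<le> card (X \<times> {..<n})" by (rule surj_card_le[rotated]) (simp add: X)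
  then have cC: "card C \<le> L * n * n" by (simp add: X card_cartesian_product)
  have bb: "8 * n * b = b ^ L" using assms by (simp flip: assms(1) add: power_eq_if)
  have pair: "8 * n * card {p \<in> samples b L n. same_line L (fst (fst c)) (p (fst c)) (p (snd c))}
      \<le> card (samples b L n)" (is "8 * n * card ?P \<le> _") if c: "c \<in> C" for c
  proof -
    obtain i a a' where ia: "c = ((i, a), (i, a'))" "a \<noteq> a'" "i < L" "a < n" "a' < n"
      using c by (cases c) (auto simp: C_def X_def, blast)
    define T where "T = (\<Union>w\<in>cube b L. (\<lambda>w'. [w', w]) ` {w' \<in> cube b L. same_line L i w' w})"
    have finT: "finite T" by (simp add: T_def)
    have "card T \<le> (\<Sum>w\<in>cube b L. card ((\<lambda>w'. [w', w]) ` {w' \<in> cube b L. same_line L i w' w}))"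
      unfolding T_def by (rule card_UN_le) simp
    also have "\<dots> \<le> (\<Sum>w\<in>cube b L. b)"
    proof (rule sum_mono)
      fix w
      show "card ((\<lambda>w'. [w', w]) ` {w' \<in> cube b L. same_line L i w' w}) \<le> b"
        using card_line_le[OF ia(3), of b w]
          card_image_le[of "{w' \<in> cube b L. same_line L i w' w}" "\<lambda>w'. [w', w]"] by simp
    qed
    also have "\<dots> = b ^ L * b" by (simp add: card_cube)
    finally have cT: "card T \<le> b ^ L * b" .
    have sub: "{(i, a), (i, a')} \<subseteq> X" using ia by (auto simp: X_def)
    have two: "2 \<le> L * n" using card_mono[OF X(1) sub] ia X by simp
    have "?P \<subseteq> {p \<in> PiE X (\<lambda>_. cube b L). map p [(i, a), (i, a')] \<in> T}"
      using sub by (auto simp: ia samples_def X_def[symmetric] T_def PiE_iff)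
    then have "card ?P \<le> card {p \<in> PiE X (\<lambda>_. cube b L). map p [(i, a), (i, a')] \<in> T}"
      by (rule card_mono[rotated]) (simp add: finite_PiE X)
    also have "\<dots> \<le> card T * card (cube b L) ^ (card X - length [(i, a), (i, a')])"
      by (rule card_PiE_map_le) (use X finT ia sub in auto)
    also have "\<dots> \<le> (b ^ L * b) * (b ^ L) ^ (L * n - 2)"
      using cT by (simp add: X card_cube numeral_2_eq_2)
    finally have "8 * n * card ?P \<le> 8 * n * ((b ^ L * b) * (b ^ L) ^ (L * n - 2))"
      by (rule mult_left_mono) simp
    also have "\<dots> = (b ^ L) ^ 2 * (b ^ L) ^ (L * n - 2)"
      using bb by (simp add: power2_eq_square algebra_simps)
    also have "\<dots> = (b ^ L) ^ (L * n)"
      using two by (simp only: power_add[symmetric] le_add_diff_inverse)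
    finally show ?thesis by (simp add: card_samples)
  qed
  have "(\<Sum>p\<in>samples b L n. card (crowded L n p))
      \<le> (\<Sum>c\<in>C. card {p \<in> samples b L n. same_line L (fst (fst c)) (p (fst c)) (p (snd c))})"
  proof (rule sum_card_le_double_count[where h = fst])
    fix p
    let ?R = "{c \<in> C. same_line L (fst (fst c)) (p (fst c)) (p (snd c))}"
    show "crowded L n p \<subseteq> fst ` ?R"
    proof
      fix v assume "v \<in> crowded L n p"
      then obtain v' where "v \<in> X" "v' \<in> X" "v' \<noteq> v" "fst v' = fst v"
        "same_line L (fst v) (p v) (p v')"
        unfolding crowded_def X_def by blast
      then have "(v, v') \<in> ?R" by (simp add: C_def)
      then show "v \<in> fst ` ?R" by force
    qed
  qed (use finC in auto)
  then have "8 * n * (\<Sum>p\<in>samples b L n. card (crowded L n p))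
      \<le> (\<Sum>c\<in>C. 8 * n * card {p \<in> samples b L n. same_line L (fst (fst c)) (p (fst c)) (p (snd c))})"
    using mult_left_mono[of _ _ "8 * n"] by (simp only: sum_distrib_left[symmetric])
  also have "\<dots> \<le> (\<Sum>c\<in>C. card (samples b L n))" by (intro sum_mono pair)
  also have "\<dots> \<le> L * n * n * card (samples b L n)" using cC by simp
  finally show ?thesis using assms(2) by (simp add: mult_ac)
qed

text \<open>The list \<open>y # zs\<close> has \<open>r + 2\<close> entries, the length of the cycle
  to be destroyed. Only the positions of its vertices are tested, not their adjacency, so more
  vertices than necessary may be deleted.\<close>

definition bent :: "nat \<Rightarrow> nat \<Rightarrow> nat \<Rightarrow> nat \<Rightarrow> (nat \<times> nat \<Rightarrow> nat \<Rightarrow> nat) \<Rightarrow> (nat \<times> nat) set" where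
  "bent b L n g p = {y. \<exists>r zs. r + 2 < g \<and> length zs = Suc r \<and> distinct (y # zs) \<and>
     set (y # zs) \<subseteq> {..<L} \<times> {..<n} \<and> map p (y # zs) \<in> bent_walks b L r}"

text \<open>There are at most \<open>(L * n) ^ (r + 2)\<close> lists of length \<open>r + 2\<close>,
  and each is bent with probability at most
  \<open>b ^ L * (L * b) ^ r * L\<^sup>2 / (b ^ L) ^ (r + 2)\<close>. As
  \<open>n * b \<le> b ^ L\<close>, the product is at most \<open>n * L ^ (2 * g) / b\<close>.
  Summed over fewer than \<open>g\<close> values of \<open>r\<close>, this is at most
  \<open>n / 8\<close> by the choice of \<open>b\<close>.\<close>

lemma sum_card_bent_le:
  assumes n: "b ^ (L - 1) = 8 * n" and L: "0 < L" and b: "b = 8 * (g * L ^ (2 * g))" "0 < b"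
  shows "8 * (\<Sum>p\<in>samples b L n. card (bent b L n g p)) \<le> n * card (samples b L n)"
proof -
  define X where "X = {..<L} \<times> {..<n}"
  define D where "D = (\<lambda>r. {vs. set vs \<subseteq> X \<and> length vs = r + 2})"
  define D' where "D' = (\<lambda>r. {vs \<in> D r. distinct vs})"
  define C where "C = Sigma {r. r + 2 < g} D'"
  have X: "finite X" "card X = L * n" by (simp_all add: X_def)
  have finD: "finite (D r)" for r by (simp add: D_def X finite_lists_length_eq)
  then have finD': "finite (D' r)" for r by (simp add: D'_def)
  have fing: "finite {r. r + 2 < g}" by (rule finite_subset[of _ "{..<g}"]) auto
  have finC: "finite C" using finD' fing by (auto simp: C_def)
  have cD': "card (D' r) \<le> (L * n) ^ (r + 2)" for r
  proof -
    have "card (D' r) \<le> card (D r)" using finD by (intro card_mono) (auto simp: D'_def)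
    then show ?thesis using card_lists_length_eq[OF X(1), of "r + 2"] by (simp only: D_def X)
  qed
  have nb: "n * b \<le> b ^ L" using n L by (cases L) auto
  have key: "b * (\<Sum>vs\<in>D' r. card {p \<in> samples b L n. map p vs \<in> bent_walks b L r})
      \<le> n * L ^ (2 * g) * card (samples b L n)" if r: "r + 2 < g" for r
  \<comment> \<open>If a list exists at all, then \<open>r + 2 \<le> L * n\<close>, so the
    subtraction in the exponent of \<open>?E\<close> is exact.\<close>
  proof (cases "D' r = {}")
    case False
    then obtain vs where vs: "vs \<in> D' r" by blast
    have "r + 2 \<le> L * n"
      using vs card_mono[OF X(1), of "set vs"] X by (auto simp: D'_def D_def distinct_card)
    then have pow: "(b ^ L) ^ (r + 2) * (b ^ L) ^ (L * n - (r + 2)) = card (samples b L n)"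
      by (simp only: card_samples power_add[symmetric] le_add_diff_inverse)
    let ?E = "(b ^ L) ^ (L * n - (r + 2))"
    have "card {p \<in> samples b L n. map p vs \<in> bent_walks b L r} \<le> b ^ L * (L * b) ^ r * L\<^sup>2 * ?E"
      if "vs \<in> D' r" for vs
    proof -
      have "card {p \<in> samples b L n. map p vs \<in> bent_walks b L r}
          \<le> card (bent_walks b L r) * card (cube b L) ^ (card X - length vs)"
        unfolding samples_def X_def[symmetric]
        by (rule card_PiE_map_le) (use that X in \<open>auto simp: D'_def D_def\<close>)
      also have "\<dots> = card (bent_walks b L r) * ?E"
        using that by (simp add: D'_def D_def X card_cube)
      finally show ?thesis using card_bent_walks_le[of b L r] by (meson le_trans mult_le_mono1)
    qed
    then have "(\<Sum>vs\<in>D' r. card {p \<in> samples b L n. map p vs \<in> bent_walks b L r})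
        \<le> (\<Sum>vs\<in>D' r. b ^ L * (L * b) ^ r * L\<^sup>2 * ?E)"
      by (rule sum_mono)
    also have "\<dots> = card (D' r) * (b ^ L * (L * b) ^ r * L\<^sup>2 * ?E)" by simp
    also have "\<dots> \<le> (L * n) ^ (r + 2) * (b ^ L * (L * b) ^ r * L\<^sup>2 * ?E)"
      by (rule mult_right_mono[OF cD']) simp
    finally have "b * (\<Sum>vs\<in>D' r. card {p \<in> samples b L n. map p vs \<in> bent_walks b L r})
        \<le> b * ((L * n) ^ (r + 2) * (b ^ L * (L * b) ^ r * L\<^sup>2 * ?E))"
      by (rule mult_left_mono) simp
    \<comment> \<open>One factor \<open>n\<close> stays alone; the other \<open>r + 1\<close> are
      paired with the \<open>r\<close> factors \<open>b\<close> of the walk and the additional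
      \<open>b\<close> in front.\<close>
    also have "\<dots> = n * L ^ (2 * (r + 2)) * ((n * b) ^ (r + 1) * b ^ L * ?E)"
      by (simp add: power_mult_distrib power_add power2_eq_square power_mult)
    also have "\<dots> \<le> n * L ^ (2 * g) * ((b ^ L) ^ (r + 1) * b ^ L * ?E)"
      using r L by (intro mult_mono power_mono nb power_increasing) auto
    also have "(b ^ L) ^ (r + 1) * b ^ L * ?E = card (samples b L n)"
      by (simp only: pow[symmetric]) simp
    finally show ?thesis .
  qed simp
  have "(\<Sum>p\<in>samples b L n. card (bent b L n g p))
      \<le> (\<Sum>c\<in>C. card {p \<in> samples b L n. map p (snd c) \<in> bent_walks b L (fst c)})"
  proof (rule sum_card_le_double_count[where h = "\<lambda>c. hd (snd c)"])
    fix p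
    show "bent b L n g p \<subseteq> (\<lambda>c. hd (snd c)) ` {c \<in> C. map p (snd c) \<in> bent_walks b L (fst c)}"
    proof
      fix y assume "y \<in> bent b L n g p"
      then obtain r zs where "r + 2 < g" "length zs = Suc r" "distinct (y # zs)"
        "set (y # zs) \<subseteq> X" "map p (y # zs) \<in> bent_walks b L r"
        unfolding bent_def X_def by blast
      then have "(r, y # zs) \<in> {c \<in> C. map p (snd c) \<in> bent_walks b L (fst c)}"
        by (simp add: C_def D'_def D_def)
      then show "y \<in> (\<lambda>c. hd (snd c)) ` {c \<in> C. map p (snd c) \<in> bent_walks b L (fst c)}"
        by force
    qed
  qed (use finC in auto)
  also have "\<dots> = (\<Sum>r | r + 2 < g. \<Sum>vs\<in>D' r. card {p \<in> samples b L n. map p vs \<in> bent_walks b L r})"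
    unfolding C_def using fing finD' by (subst sum.Sigma) (auto simp: case_prod_unfold)
  finally have "b * (\<Sum>p\<in>samples b L n. card (bent b L n g p))
      \<le> (\<Sum>r | r + 2 < g. b * (\<Sum>vs\<in>D' r. card {p \<in> samples b L n. map p vs \<in> bent_walks b L r}))"
    using mult_left_mono[of _ _ b] by (simp only: sum_distrib_left[symmetric])
  also have "\<dots> \<le> (\<Sum>r | r + 2 < g. n * L ^ (2 * g) * card (samples b L n))"
    by (intro sum_mono key) simp
  also have "\<dots> = card {r. r + 2 < g} * (n * L ^ (2 * g) * card (samples b L n))" by simp
  also have "\<dots> \<le> g * (n * L ^ (2 * g) * card (samples b L n))"
  proof (rule mult_right_mono)
    have "card {r. r + 2 < g} \<le> card {..<g}" by (rule card_mono) auto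
    then show "card {r. r + 2 < g} \<le> g" by simp
  qed simp
  finally have "(g * L ^ (2 * g)) * (8 * (\<Sum>p\<in>samples b L n. card (bent b L n g p)))
      \<le> (g * L ^ (2 * g)) * (n * card (samples b L n))"
    by (subst (asm) b) (simp add: mult_ac)
  then show ?thesis using b by (simp only: mult_le_cancel1)
qed

section \<open>Girth after the deletion\<close>

lemma is_cycle_rotate:
  assumes "is_cycle V E vs"
  shows "is_cycle V E (rotate k vs)"
proof -
  have "E (rotate k vs ! i) (rotate k vs ! ((i + 1) mod length vs))" if "i < length vs" for i
  proof -
    have "(k + i) mod length vs < length vs"
      using that by (intro mod_less_divisor) linarith
    then have "E (vs ! ((k + i) mod length vs)) (vs ! (((k + i) mod length vs + 1) mod length vs))"
      using assms unfolding is_cycle_def by blast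
    moreover have "((k + i) mod length vs + 1) mod length vs = (k + (i + 1) mod length vs) mod length vs"
      by (simp add: mod_simps)
    moreover have "(i + 1) mod length vs < length vs"
      using that by (intro mod_less_divisor) linarith
    ultimately show ?thesis
      using that nth_rotate[of i vs k] nth_rotate[of "(i + 1) mod length vs" vs k] by simp
  qed
  then show ?thesis using assms by (simp add: is_cycle_def)
qed

definition kept :: "nat \<Rightarrow> nat \<Rightarrow> nat \<Rightarrow> nat \<Rightarrow> (nat \<times> nat \<Rightarrow> nat \<Rightarrow> nat) \<Rightarrow> (nat \<times> nat) set" where
  "kept b L n g p = {..<L} \<times> {..<n} - crowded L n p - bent b L n g p"

lemma sample_edge_same_line:
  "sample_edge L p u v \<Longrightarrow> same_line L (min (fst u) (fst v)) (p u) (p v)"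
  by (auto simp: sample_edge_def sample_arc_def min_def intro: same_line_sym)

text \<open>On a cycle take a vertex v of minimal type i, followed by y and z. The edge vy has
  direction i. If z has type i as well, then v and z lie on a common line of direction i, so
  that v is crowded; otherwise the edge yz has another direction, and the cycle bends at y.\<close>

lemma girth_kept:
  assumes p: "p \<in> samples b L n"
  shows "girth_ge (kept b L n g p) (sample_edge L p) g"
  unfolding girth_ge_def
proof (intro allI impI, rule ccontr)
  fix vs0 assume c0: "is_cycle (kept b L n g p) (sample_edge L p) vs0" and short: "\<not> g \<le> length vs0"
  let ?V = "kept b L n g p" and ?E = "sample_edge L p"
  have VX: "?V \<subseteq> {..<L} \<times> {..<n}" by (auto simp: kept_def)
  define k where "k = (ARG_MIN (\<lambda>k. fst (vs0 ! k)) k. k < length vs0)"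
  have len0: "3 \<le> length vs0" using c0 by (simp add: is_cycle_def)
  have kmin: "k < length vs0" "\<And>j. j < length vs0 \<Longrightarrow> fst (vs0 ! k) \<le> fst (vs0 ! j)"
    using arg_min_nat_lemma[of "\<lambda>k. k < length vs0" 0 "\<lambda>k. fst (vs0 ! k)"] len0
    unfolding k_def by force+
  have c1: "is_cycle ?V ?E (rotate k vs0)" by (rule is_cycle_rotate[OF c0])
  have "length (rotate k vs0) \<ge> 3" using len0 by simp
  then obtain v y z rest where vs1: "rotate k vs0 = v # y # z # rest"
    by (metis Suc_le_length_iff numeral_3_eq_3)
  have v: "v = vs0 ! k" using nth_rotate[of 0 vs0 k] kmin(1) len0 vs1 by (cases vs0) auto
  have set1: "set vs0 = set (v # y # z # rest)" using vs1 by (metis set_rotate)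
  have vmin: "fst v \<le> fst u" if "u \<in> set (v # y # z # rest)" for u
    using that kmin(2) set1 v by (metis in_set_conv_nth)
  \<comment> \<open>One further rotation puts the bend \<open>y\<close> in front and
    \<open>v\<close> at the end, so that \<open>zs\<close> runs from one neighbour of
    \<open>y\<close> to the other.\<close>
  define zs where "zs = z # rest @ [v]"
  have "rotate 1 (rotate k vs0) = y # zs" by (simp add: vs1 zs_def)
  then have c2: "is_cycle ?V ?E (y # zs)" using is_cycle_rotate[OF c1, of 1] by simp
  have len: "length (y # zs) = length vs0" using vs1 by (metis zs_def length_rotate length_append_singleton length_Cons)
  have dist: "distinct (y # zs)" and sub: "set (y # zs) \<subseteq> ?V"
    and E: "\<And>i. i < length (y # zs) \<Longrightarrow> ?E ((y # zs) ! i) ((y # zs) ! ((i + 1) mod length (y # zs)))"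
    using c2 unfolding is_cycle_def by blast+
  define r where "r = Suc (length rest)"
  have lzs: "length zs = Suc r" by (simp add: zs_def r_def)
  have Eyz: "?E y z" using E[of 0] by (simp add: zs_def)
  have Evy: "?E v y" using E[of "Suc r"] lzs by (simp add: zs_def r_def nth_append)
  have Ezs: "?E (zs ! i) (zs ! Suc i)" if "i < r" for i
    using E[of "Suc i"] that lzs by simp
  have inX: "u \<in> {..<L} \<times> {..<n}" if "u \<in> set (y # zs)" for u using that sub VX by blast
  have vin: "v \<in> set (y # zs)" "z \<in> set (y # zs)" by (auto simp: zs_def)
  define i where "i = fst v"
  \<comment> \<open>Adjacent vertices have different types, so \<open>y\<close> lies strictly above
    the minimal type \<open>i\<close>.\<close>
  have "fst v \<noteq> fst y" using Evy by (auto simp: sample_edge_def sample_arc_def)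
  then have iy: "i < fst y" using vmin[of y] by (simp add: i_def)
  have lvy: "same_line L i (p v) (p y)" using sample_edge_same_line[OF Evy] iy by (simp add: i_def)
  have lyz: "same_line L (min (fst y) (fst z)) (p y) (p z)" by (rule sample_edge_same_line[OF Eyz])
  show False
  proof (cases "fst z = i")
    case True
    have "same_line L i (p v) (p z)"
      using lvy lyz iy True by (auto intro: same_line_trans simp: min_def)
    moreover have "z \<noteq> v" using dist by (auto simp: zs_def)
    ultimately have "v \<in> crowded L n p"
      using inX[OF vin(1)] inX[OF vin(2)] True unfolding crowded_def i_def by blast
    then show False using sub vin by (auto simp: kept_def)
  next
    case False
    then have "i < fst z" using vmin[of z] by (simp add: i_def)
    then have d: "min (fst y) (fst z) \<noteq> i" using iy by simp
    have Lt: "fst u < L" if "u \<in> set (y # zs)" for u using inX[OF that] by (auto simp: mem_Times_iff)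
    have inQ: "p u \<in> cube b L" if "u \<in> set (y # zs)" for u
      using p inX[OF that] unfolding samples_def by (rule PiE_mem)
    have "\<exists>d<L. same_line L d (map p zs ! j) (map p zs ! Suc j)" if "j < r" for j
    proof -
      have "zs ! j \<in> set (y # zs)" using that lzs by simp
      then have "min (fst (zs ! j)) (fst (zs ! Suc j)) < L" using Lt[of "zs ! j"] by simp
      then show ?thesis using sample_edge_same_line[OF Ezs[OF that]] that lzs by auto
    qed
    then have "map p zs \<in> walks b L r" using lzs inQ by (auto simp: walks_def)
    moreover have "same_line L (min (fst y) (fst z)) (p y) (hd (map p zs))"
      using lyz by (simp add: zs_def)
    moreover have "same_line L i (p y) (last (map p zs))"
      using same_line_sym[OF lvy] by (simp add: zs_def)
    moreover have "min (fst y) (fst z) < L" "i < L" using Lt[of y] Lt[OF vin(1)] by (auto simp: i_def)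
    ultimately have "map p (y # zs) \<in> bent_walks b L r"
      using d inQ[of y] unfolding bent_walks_def by auto
    moreover have "r + 2 < g" using short len lzs by simp
    moreover have "set (y # zs) \<subseteq> {..<L} \<times> {..<n}" using inX by blast
    ultimately have "y \<in> bent b L n g p"
      using lzs dist unfolding bent_def by blast
    then show False using sub by (auto simp: kept_def)
  qed
qed

section \<open>Existence of a good sample\<close>

text \<open>With \<open>s = L * n / K\<close> the ratio \<open>n / s\<close> is
  \<open>2 ^ (- 10 * K)\<close>, so \<open>(n / s) ^ s\<close> is \<open>2 ^ (- 10 * L * n)\<close>.
  This beats the \<open>2 ^ (9 * L * n)\<close> choices in the union bound and dictates
  \<open>L\<close>. The factor \<open>b\<close> is taken large enough for the bound on bends, and
  \<open>n\<close> is written so that \<open>8 * n = b ^ (L - 1)\<close> holds without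
  division.\<close>

lemma exists_good_sample:
  fixes K g :: nat
  assumes K: "0 < K" and g: "0 < g"
  defines "L \<equiv> K * 2 ^ (10 * K)"
  defines "b \<equiv> 8 * (g * L ^ (2 * g))"
  defines "n \<equiv> g * L ^ (2 * g) * b ^ (L - 2)"
  obtains p where "p \<in> samples b L n" "L * n \<le> 2 * card (kept b L n g p)"
    "\<And>S. S \<subseteq> {..<L} \<times> {..<n} \<Longrightarrow> (\<And>u v. u \<in> S \<Longrightarrow> v \<in> S \<Longrightarrow> \<not> sample_edge L p u v) \<Longrightarrow>
       K * card S \<le> L * n"
proof -
  have L2: "2 \<le> L"
  proof -
    have "(2::nat) ^ 1 \<le> 2 ^ (10 * K)" by (rule power_increasing) (use K in auto)
    then show ?thesis using K unfolding L_def by (metis One_nat_def Suc_leI mult_le_mono nat_mult_1 power_one_right)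
  qed
  have b: "0 < b" using g L2 by (simp add: b_def)
  have n: "0 < n" using g L2 b by (simp add: n_def)
  have bn: "b ^ (L - 1) = 8 * n"
  proof -
    have "L - 1 = Suc (L - 2)" using L2 by simp
    then show ?thesis by (simp add: n_def b_def)
  qed
  let ?\<Omega> = "samples b L n"
  define N where "N = card ?\<Omega>"
  define s where "s = 2 ^ (10 * K) * n"
  have s: "0 < s" "K * s = L * n" using n by (simp_all add: s_def L_def)
  have Npos: "0 < N" using b by (simp add: N_def card_samples)
  define Bad where "Bad = {p \<in> ?\<Omega>. \<exists>S \<subseteq> {..<L} \<times> {..<n}. card S = s \<and>
            (\<forall>u\<in>S. \<forall>v\<in>S. \<not> sample_arc L p u v)}"
  have "real (card Bad) \<le> 2 ^ (L * n) * (2 ^ (b ^ (L - 1))) ^ L * (real n / real s) ^ s * real N"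
    unfolding Bad_def N_def by (rule card_independent_samples_le[OF b s(1)])
  also have "real n / real s = 1 / 2 ^ (10 * K)" using n by (simp add: s_def)
  also have "(1 / 2 ^ (10 * K) :: real) ^ s = 1 / 2 ^ (10 * (L * n))"
    by (simp add: power_one_over mult.assoc flip: s(2) power_mult)
  \<comment> \<open>The sets \<open>S\<close> contribute the exponent \<open>L * n\<close>, the
    families \<open>U\<close> contribute \<open>8 * n * L\<close>.\<close>
  also have "(2 ^ (L * n) * (2 ^ (b ^ (L - 1))) ^ L :: real) = 2 ^ (9 * (L * n))"
    by (simp only: bn power_mult[symmetric] power_add[symmetric]) (simp add: algebra_simps)
  also have "(2 ^ (9 * (L * n)) * (1 / 2 ^ (10 * (L * n))) * real N :: real) = real N / 2 ^ (L * n)"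
  proof -
    have "(2 :: real) ^ (10 * (L * n)) = 2 ^ (9 * (L * n)) * 2 ^ (L * n)"
      by (simp flip: power_add)
    then show ?thesis by simp
  qed
  also have "\<dots> \<le> real N / 4"
  proof -
    have "2 * 1 \<le> L * n" using L2 n by (intro mult_le_mono) auto
    then have "(2 :: real) ^ 2 \<le> 2 ^ (L * n)" by (intro power_increasing) auto
    then show ?thesis by (intro divide_left_mono) auto
  qed
  finally have Bad: "4 * card Bad \<le> N" by linarith
  have L0: "0 < L" using L2 by simp
  define f where "f = (\<lambda>p. card (crowded L n p) + card (bent b L n g p))"
  have "8 * (\<Sum>p\<in>?\<Omega>. f p) \<le> L * n * N + n * N"
    using sum_card_crowded_le[OF bn n L0] sum_card_bent_le[OF bn L0 b_def[THEN meta_eq_to_obj_eq] b]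
    by (simp add: f_def sum.distrib N_def)
  also have "\<dots> \<le> 2 * (L * n * N)" using L0 by simp
  finally have fsum: "4 * (\<Sum>p\<in>?\<Omega>. f p) \<le> L * n * N" by linarith
  \<comment> \<open>Markov's inequality: the mean of \<open>f\<close> is at most
    \<open>L * n / 4\<close>. If \<open>f\<close> were at least \<open>L * n / 2\<close> on all
    samples outside \<open>Bad\<close>, which are at least three quarters, the mean would be at
    least \<open>3 * L * n / 8\<close>.\<close>
  have "\<exists>p\<in>?\<Omega> - Bad. 2 * f p \<le> L * n"
  proof (rule ccontr)
    assume "\<not> ?thesis"
    then have big: "L * n \<le> 2 * f p" if "p \<in> ?\<Omega> - Bad" for p using that by force
    have BO: "Bad \<subseteq> ?\<Omega>" by (auto simp: Bad_def)
    then have cO: "card (?\<Omega> - Bad) = N - card Bad"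
      by (simp add: N_def card_Diff_subset finite_subset[OF BO])
    have "card (?\<Omega> - Bad) * (L * n) = (\<Sum>p\<in>?\<Omega> - Bad. L * n)" by simp
    also have "\<dots> \<le> (\<Sum>p\<in>?\<Omega> - Bad. 2 * f p)" by (intro sum_mono big)
    also have "\<dots> \<le> (\<Sum>p\<in>?\<Omega>. 2 * f p)" by (rule sum_mono2) auto
    finally have "2 * ((N - card Bad) * (L * n)) \<le> L * n * N"
      using fsum by (simp only: cO sum_distrib_left[symmetric])
    then have "(2 * (N - card Bad)) * (L * n) \<le> N * (L * n)" by (simp add: mult_ac)
    then have "2 * (N - card Bad) \<le> N" using n L0 by simp
    then show False using Bad Npos by linarith
  qed
  then obtain p where p: "p \<in> ?\<Omega>" "p \<notin> Bad" "2 * f p \<le> L * n" by blast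
  show ?thesis
  proof (rule that[OF p(1)])
    have fin: "finite (crowded L n p \<union> bent b L n g p)"
      by (rule finite_subset[of _ "{..<L} \<times> {..<n}"]) (auto simp: crowded_def bent_def)
    have "L * n - card (crowded L n p \<union> bent b L n g p)
        \<le> card ({..<L} \<times> {..<n} - (crowded L n p \<union> bent b L n g p))"
      using diff_card_le_card_Diff[OF fin, of "{..<L} \<times> {..<n}"] by simp
    also have "{..<L} \<times> {..<n} - (crowded L n p \<union> bent b L n g p) = kept b L n g p"
      by (auto simp: kept_def)
    finally have "L * n - card (crowded L n p \<union> bent b L n g p) \<le> card (kept b L n g p)" .
    moreover have "card (crowded L n p \<union> bent b L n g p) \<le> f p" by (simp add: f_def card_Un_le)
    ultimately show "L * n \<le> 2 * card (kept b L n g p)" using p(3) by linarith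
  next
    fix S assume S: "S \<subseteq> {..<L} \<times> {..<n}"
      and ind: "\<And>u v. u \<in> S \<Longrightarrow> v \<in> S \<Longrightarrow> \<not> sample_edge L p u v"
    have "card S < s"
    proof (rule ccontr)
      assume "\<not> card S < s"
      \<comment> \<open>\<open>Bad\<close> speaks of sets of size exactly \<open>s\<close>, so a
        larger independent set is cut down to that size.\<close>
      then obtain T where T: "T \<subseteq> S" "card T = s" by (metis not_less obtain_subset_with_card_n)
      have "\<not> sample_arc L p u v" if "u \<in> T" "v \<in> T" for u v
        using ind[of u v] that T(1) by (auto simp: sample_edge_def)
      then have "T \<subseteq> {..<L} \<times> {..<n} \<and> card T = s \<and> (\<forall>u\<in>T. \<forall>v\<in>T. \<not> sample_arc L p u v)"
        using T S by simp
      then have "p \<in> Bad" using p(1) unfolding Bad_def by (intro CollectI conjI exI[of _ T]) simp_all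
      then show False using p(2) by simp
    qed
    then show "K * card S \<le> L * n" using mult_le_mono2[of "card S" s K] by (simp only: s(2) less_imp_le)
  qed
qed

subsection \<open>Semilinear realisation\<close>

lemma cycle_image:
  assumes "inj_on f V"
    and "is_cycle (f ` V) (\<lambda>x y. \<exists>u\<in>V. \<exists>v\<in>V. x = f u \<and> y = f v \<and> E u v) ws"
  shows "is_cycle V E (map (the_inv_into V f) ws)"
proof -
  let ?h = "the_inv_into V f"
  have len: "3 \<le> length ws" and dist: "distinct ws" and sub: "set ws \<subseteq> f ` V"
    and E: "\<And>i. i < length ws \<Longrightarrow>
      \<exists>u\<in>V. \<exists>v\<in>V. ws ! i = f u \<and> ws ! ((i + 1) mod length ws) = f v \<and> E u v"
    using assms(2) unfolding is_cycle_def by blast+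
  have "inj_on ?h (set ws)"
    using inj_on_the_inv_into[OF assms(1)] sub by (rule inj_on_subset)
  then have "distinct (map ?h ws)" using dist by (simp add: distinct_map)
  moreover have "set (map ?h ws) \<subseteq> V"
    using sub the_inv_into_into[OF assms(1) _ subset_refl] by auto
  moreover have "E (map ?h ws ! i) (map ?h ws ! ((i + 1) mod length ws))" if i: "i < length ws" for i
  proof -
    obtain u v where "u \<in> V" "v \<in> V" "ws ! i = f u" "ws ! ((i + 1) mod length ws) = f v" "E u v"
      using E[OF i] by blast
    moreover have "(i + 1) mod length ws < length ws"
      using i by (intro mod_less_divisor) linarith
    ultimately show ?thesis using i the_inv_into_f_f[OF assms(1)] by simp
  qed
  ultimately show ?thesis using len by (simp add: is_cycle_def)
qed

lemma girth_image:
  assumes "inj_on f V" "girth_ge V E g"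
  shows "girth_ge (f ` V) (\<lambda>x y. \<exists>u\<in>V. \<exists>v\<in>V. x = f u \<and> y = f v \<and> E u v) g"
  unfolding girth_ge_def
proof (intro allI impI)
  fix ws assume "is_cycle (f ` V) (\<lambda>x y. \<exists>u\<in>V. \<exists>v\<in>V. x = f u \<and> y = f v \<and> E u v) ws"
  then have "is_cycle V E (map (the_inv_into V f) ws)" by (rule cycle_image[OF assms(1)])
  then have "g \<le> length (map (the_inv_into V f) ws)" using assms(2) unfolding girth_ge_def by blast
  then show "g \<le> length ws" by simp
qed

text \<open>Adjacent vertices share their first component, so a cycle stays within one copy and the
  projection \<open>snd\<close> is injective on it.\<close>

lemma girth_copies:
  assumes "girth_ge V E g"
  shows "girth_ge ({..<k} \<times> V) (\<lambda>u v. fst u = fst v \<and> E (snd u) (snd v)) g"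
  unfolding girth_ge_def
proof (intro allI impI)
  fix ws assume c: "is_cycle ({..<k} \<times> V) (\<lambda>u v. fst u = fst v \<and> E (snd u) (snd v)) ws"
  have len: "3 \<le> length ws" and dist: "distinct ws" and sub: "set ws \<subseteq> {..<k} \<times> V"
    and E: "\<And>i. i < length ws \<Longrightarrow> fst (ws ! i) = fst (ws ! ((i + 1) mod length ws))
        \<and> E (snd (ws ! i)) (snd (ws ! ((i + 1) mod length ws)))"
    using c by (simp_all add: is_cycle_def)
  have same: "fst (ws ! i) = fst (ws ! 0)" if "i < length ws" for i
    using that
  proof (induction i)
    case (Suc i)
    then show ?case using E[of i] by simp
  qed simp
  have "inj_on snd (set ws)"
    by (rule inj_onI) (use same in \<open>metis in_set_conv_nth prod_eqI\<close>)
  then have "distinct (map snd ws)" using dist by (simp add: distinct_map)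
  moreover have "set (map snd ws) \<subseteq> V" using sub by auto
  moreover have "E (map snd ws ! i) (map snd ws ! ((i + 1) mod length ws))" if i: "i < length ws" for i
  proof -
    have "(i + 1) mod length ws < length ws"
      using i by (intro mod_less_divisor) linarith
    then show ?thesis using E[OF i] i by simp
  qed
  ultimately have "is_cycle V E (map snd ws)" using len by (simp add: is_cycle_def)
  then show "g \<le> length ws" using assms unfolding girth_ge_def by fastforce
qed

section \<open>Base-\<open>b\<close> numbers read from the leading digit, and the interval of a
  prefix\<close>

fun code :: "nat \<Rightarrow> (nat \<Rightarrow> nat) \<Rightarrow> nat \<Rightarrow> nat" where
  "code b w 0 = 0"
| "code b w (Suc i) = b * code b w i + w i"

lemma code_add:
  assumes "\<And>c. c < i + j \<Longrightarrow> w c < b"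
  shows "b ^ j * code b w i \<le> code b w (i + j) \<and> code b w (i + j) < b ^ j * (code b w i + 1)"
  using assms
proof (induction j)
  case (Suc j)
  then have IH: "b ^ j * code b w i \<le> code b w (i + j)" "code b w (i + j) + 1 \<le> b ^ j * (code b w i + 1)"
    by auto
  have w: "w (i + j) < b" using Suc.prems by simp
  have "b * (b ^ j * code b w i) \<le> b * code b w (i + j)"
    using IH(1) by (rule mult_left_mono) simp
  moreover have "b * code b w (i + j) + b \<le> b * (b ^ j * (code b w i + 1))"
    using mult_left_mono[OF IH(2), of b] by simp
  ultimately show ?case using w by (simp only: add_Suc_right code.simps power_Suc mult.assoc) linarith
qed simp

lemma code_eq_iff:
  assumes "\<And>c. c < i \<Longrightarrow> w c < b" "\<And>c. c < i \<Longrightarrow> w' c < b"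
  shows "code b w i = code b w' i \<longleftrightarrow> (\<forall>c<i. w c = w' c)"
  using assms
proof (induction i)
  case (Suc i)
  have lt: "w i < b" "w' i < b" using Suc.prems by auto
  have "code b w (Suc i) = code b w' (Suc i) \<longleftrightarrow> code b w i = code b w' i \<and> w i = w' i"
  proof
    assume eq: "code b w (Suc i) = code b w' (Suc i)"
    have "code b w (Suc i) div b = code b w i" "code b w' (Suc i) div b = code b w' i"
      "code b w (Suc i) mod b = w i" "code b w' (Suc i) mod b = w' i"
      using lt by auto
    then show "code b w i = code b w' i \<and> w i = w' i" using eq by metis
  qed simp
  then show ?case using Suc by (auto simp: less_Suc_eq)
qed simp

text \<open>By \<open>code_add\<close> every word lies in the block of \<open>b ^ (L - i)\<close>
  numbers belonging to its prefix of length \<open>i\<close>. Blocks of different prefix codes are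
  disjoint, so membership in the block of \<open>w\<close> forces equal prefixes. Agreement of
  prefixes thus becomes two inequalities.\<close>

lemma code_interval_iff:
  assumes "\<And>c. c < L \<Longrightarrow> w c < b" "\<And>c. c < L \<Longrightarrow> w' c < b" "i \<le> L"
  shows "b ^ (L - i) * code b w i \<le> code b w' L \<and> code b w' L < b ^ (L - i) * (code b w i + 1)
    \<longleftrightarrow> (\<forall>c<i. w c = w' c)"
proof -
  have w': "b ^ (L - i) * code b w' i \<le> code b w' L" "code b w' L < b ^ (L - i) * (code b w' i + 1)"
    using code_add[of i "L - i" w' b] assms by auto
  have "code b w i = code b w' i"
    if h: "b ^ (L - i) * code b w i \<le> code b w' L" "code b w' L < b ^ (L - i) * (code b w i + 1)"
  proof -
    have "b ^ (L - i) * code b w i < b ^ (L - i) * (code b w' i + 1)"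
      "b ^ (L - i) * code b w' i < b ^ (L - i) * (code b w i + 1)"
      using h w' by linarith+
    then show ?thesis by (simp only: mult_less_cancel1) linarith
  qed
  then have "b ^ (L - i) * code b w i \<le> code b w' L \<and> code b w' L < b ^ (L - i) * (code b w i + 1)
      \<longleftrightarrow> code b w i = code b w' i"
    using w' by metis
  also have "\<dots> \<longleftrightarrow> (\<forall>c<i. w c = w' c)"
    using assms by (intro code_eq_iff) auto
  finally show ?thesis .
qed

definition reversed :: "nat \<Rightarrow> (nat \<Rightarrow> nat) \<Rightarrow> nat \<Rightarrow> nat" where
  "reversed L w c = w (L - 1 - c)"

text \<open>Leaving out coordinate \<open>i\<close> splits a word into a prefix and a suffix, and
  the suffix is a prefix of the reversed word.\<close>

lemma same_line_iff:
  assumes "i < L"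
  shows "same_line L i w w' \<longleftrightarrow>
    (\<forall>c<i. w c = w' c) \<and> (\<forall>c<L - 1 - i. reversed L w c = reversed L w' c)"
proof
  assume "same_line L i w w'"
  then show "(\<forall>c<i. w c = w' c) \<and> (\<forall>c<L - 1 - i. reversed L w c = reversed L w' c)"
    using assms by (auto simp: same_line_def reversed_def)
next
  assume *: "(\<forall>c<i. w c = w' c) \<and> (\<forall>c<L - 1 - i. reversed L w c = reversed L w' c)"
  show "same_line L i w w'"
    unfolding same_line_def
  proof (intro allI impI)
    fix c assume c: "c < L" "c \<noteq> i"
    show "w c = w' c"
    proof (cases "c < i")
      case False
      then have "L - 1 - c < L - 1 - i" using c by linarith
      then have "reversed L w (L - 1 - c) = reversed L w' (L - 1 - c)" using * by blast
      moreover have "L - 1 - (L - 1 - c) = c" using c by linarith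
      ultimately show ?thesis by (simp only: reversed_def)
    qed (use * in blast)
  qed
qed

text \<open>The points whose first i digits are prescribed form an interval in lexicographic order,
  those whose last digits are prescribed form one in the order of the reversed words. A vertex
  stores its two codes and the endpoints of the two intervals that cut out its line; the first
  and last coordinates separate copies and labels.\<close>

definition embed :: "nat \<Rightarrow> nat \<Rightarrow> (nat \<times> nat \<Rightarrow> nat \<Rightarrow> nat) \<Rightarrow> nat \<times> nat \<times> nat \<Rightarrow> real list" where
  "embed b L p = (\<lambda>(k, i, a). let w = p (i, a); w' = reversed L w in map real
     [k, i, code b w L, code b w' L,
      b ^ (L - i) * code b w i, b ^ (L - i) * (code b w i + 1),
      b ^ (L - (L - 1 - i)) * code b w' (L - 1 - i), b ^ (L - (L - 1 - i)) * (code b w' (L - 1 - i) + 1),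
      a])"

lemma length_embed: "length (embed b L p v) = 9"
  by (simp add: embed_def Let_def case_prod_unfold)

lemma inj_embed: "inj (embed b L p)"
proof (rule injI)
  fix u v assume eq: "embed b L p u = embed b L p v"
  have coords: "embed b L p q ! 0 = real (fst q)" "embed b L p q ! 1 = real (fst (snd q))"
    "embed b L p q ! 8 = real (snd (snd q))" for q
    by (simp_all add: embed_def Let_def case_prod_unfold)
  show "u = v"
    using coords[of u] coords[of v] by (simp add: eq prod_eq_iff)
qed

text \<open>The direction of the line is the type of \<open>u\<close>, so both intervals can be
  stored with \<open>u\<close> alone. Storing their endpoints, in which the type occurs as an
  exponent, leaves only comparisons of one coordinate of \<open>x\<close> with one of
  \<open>y\<close>, which are linear.\<close>

lemma sample_arc_embed_iff:
  assumes p: "p \<in> samples b L n" and u: "u \<in> {..<L} \<times> {..<n}" and v: "v \<in> {..<L} \<times> {..<n}"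
    and x: "x = embed b L p (k, u)" and y: "y = embed b L p (k', v)"
  shows "sample_arc L p u v \<longleftrightarrow> x ! 1 < y ! 1 \<and> x ! 4 \<le> y ! 2 \<and> y ! 2 < x ! 5 \<and>
    x ! 6 \<le> y ! 3 \<and> y ! 3 < x ! 7"
proof -
  have pu: "p u \<in> cube b L" and pv: "p v \<in> cube b L"
    using p u v unfolding samples_def by (auto intro: PiE_mem)
  obtain i a j c where uv: "u = (i, a)" "v = (j, c)" by (cases u, cases v)
  have i: "i < L" using u uv by simp
  have lt: "p u d < b" "p v d < b" "reversed L (p u) d < b" "reversed L (p v) d < b" if "d < L" for d
    using that pu pv by (auto simp: reversed_def intro: cube_less)
  let ?u = "reversed L (p (i, a))" and ?v = "reversed L (p (j, c))"
  have xs: "x ! 1 = real i" "x ! 4 = real (b ^ (L - i) * code b (p (i, a)) i)"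
      "x ! 5 = real (b ^ (L - i) * (code b (p (i, a)) i + 1))"
      "x ! 6 = real (b ^ (L - (L - 1 - i)) * code b ?u (L - 1 - i))"
      "x ! 7 = real (b ^ (L - (L - 1 - i)) * (code b ?u (L - 1 - i) + 1))"
    by (simp_all add: x uv embed_def Let_def)
  have ys: "y ! 1 = real j" "y ! 2 = real (code b (p (j, c)) L)" "y ! 3 = real (code b ?v L)"
    by (simp_all add: y uv embed_def Let_def)
  have "x ! 4 \<le> y ! 2 \<and> y ! 2 < x ! 5 \<longleftrightarrow> (\<forall>d<i. p (i, a) d = p (j, c) d)"
    unfolding xs ys of_nat_le_iff of_nat_less_iff
    by (rule code_interval_iff) (use lt i uv in auto)
  moreover have "x ! 6 \<le> y ! 3 \<and> y ! 3 < x ! 7 \<longleftrightarrow> (\<forall>d<L - 1 - i. ?u d = ?v d)"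
    unfolding xs ys of_nat_le_iff of_nat_less_iff
    by (rule code_interval_iff) (use lt i uv in auto)
  ultimately show ?thesis
    unfolding sample_arc_def uv fst_conv same_line_iff[OF i] xs(1) ys(1) of_nat_less_iff by blast
qed

definition coord_diff :: "nat \<Rightarrow> nat \<Rightarrow> linfun" where
  "coord_diff k l = (0, (\<lambda>i. if i = k then 1 else 0), (\<lambda>i. if i = l then - 1 else 0))"

lemma lin_eval_coord_diff:
  assumes "k < d" "l < d"
  shows "lin_eval d (coord_diff k l) x y = x ! k - y ! l"
proof -
  have "(\<Sum>i<d. (if i = m then c else 0) * z ! i) = c * z ! m" if "m < d" for m c and z :: "real list"
  proof -
    have "(\<Sum>i<d. (if i = m then c else 0) * z ! i) = (\<Sum>i<d. if i = m then c * z ! i else 0)"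
      by (rule sum.cong) auto
    then show ?thesis using that by simp
  qed
  then show ?thesis using assms by (simp add: lin_eval_def coord_diff_def)
qed

text \<open>One function compares the copies, one the types, and four test the intervals for each
  orientation of the arc. Their number depends on none of the parameters.\<close>

lemma semilinear_embed:
  assumes p: "p \<in> samples b L n" and V: "V \<subseteq> {..<L} \<times> {..<n}"
  shows "semilinear 10 (embed b L p ` ({..<k} \<times> V))
    (\<lambda>x y. \<exists>u\<in>{..<k} \<times> V. \<exists>v\<in>{..<k} \<times> V. x = embed b L p u \<and> y = embed b L p v \<and>
       fst u = fst v \<and> sample_edge L p (snd u) (snd v))"
    (is "semilinear 10 ?V ?E")
proof -
  define fs where "fs = [coord_diff 0 0, coord_diff 1 1,
    coord_diff 4 2, coord_diff 5 2, coord_diff 6 3, coord_diff 7 3,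
    coord_diff 2 4, coord_diff 2 5, coord_diff 3 6, coord_diff 3 7]"
  \<comment> \<open>An atom is a triple of the tests \<open>< 0\<close>, \<open>\<le> 0\<close>,
    \<open>= 0\<close>. The first line of alternatives is an arc from \<open>x\<close> to
    \<open>y\<close>, the second an arc from \<open>y\<close> to \<open>x\<close>, where the same
    type comparison must be positive.\<close>
  define \<phi> where "\<phi> = (\<lambda>s :: (bool \<times> bool \<times> bool) list. snd (snd (s ! 0)) \<and>
    (fst (s ! 1) \<and> fst (snd (s ! 2)) \<and> \<not> fst (snd (s ! 3)) \<and> fst (snd (s ! 4)) \<and> \<not> fst (snd (s ! 5)) \<or>
     \<not> fst (snd (s ! 1)) \<and> \<not> fst (s ! 6) \<and> fst (s ! 7) \<and> \<not> fst (s ! 8) \<and> fst (s ! 9)))"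
  have finV: "finite V" using V finite_subset by blast
  have edge: "?E x y \<longleftrightarrow> \<phi> (sign_atoms 9 fs x y)" if xV: "x \<in> ?V" and yV: "y \<in> ?V" for x y
  proof -
    obtain k1 u where u: "k1 < k" "u \<in> V" "x = embed b L p (k1, u)" using xV by (elim imageE SigmaE) auto
    obtain k2 v where v: "k2 < k" "v \<in> V" "y = embed b L p (k2, v)" using yV by (elim imageE SigmaE) auto
    have "?E x y \<longleftrightarrow> k1 = k2 \<and> sample_edge L p u v"
      using u v by (auto simp: inj_eq[OF inj_embed])
    moreover have "k1 = k2 \<longleftrightarrow> x ! 0 = y ! 0"
      using u v by (simp add: embed_def Let_def split: prod.split)
    moreover have "sample_arc L p u v \<longleftrightarrow> x ! 1 < y ! 1 \<and> x ! 4 \<le> y ! 2 \<and> y ! 2 < x ! 5 \<and>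
        x ! 6 \<le> y ! 3 \<and> y ! 3 < x ! 7"
      using u v V by (intro sample_arc_embed_iff[OF p]) auto
    moreover have "sample_arc L p v u \<longleftrightarrow> y ! 1 < x ! 1 \<and> y ! 4 \<le> x ! 2 \<and> x ! 2 < y ! 5 \<and>
        y ! 6 \<le> x ! 3 \<and> x ! 3 < y ! 7"
      using u v V by (intro sample_arc_embed_iff[OF p]) auto
    moreover have "\<phi> (sign_atoms 9 fs x y) \<longleftrightarrow> x ! 0 = y ! 0 \<and>
      (x ! 1 < y ! 1 \<and> x ! 4 \<le> y ! 2 \<and> y ! 2 < x ! 5 \<and> x ! 6 \<le> y ! 3 \<and> y ! 3 < x ! 7 \<or>
       y ! 1 < x ! 1 \<and> y ! 4 \<le> x ! 2 \<and> x ! 2 < y ! 5 \<and> y ! 6 \<le> x ! 3 \<and> x ! 3 < y ! 7)"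
      by (simp add: \<phi>_def sign_atoms_def fs_def lin_eval_coord_diff not_le not_less)
    ultimately show ?thesis by (simp add: sample_edge_def)
  qed
  have simple: "simple_graph ?V ?E"
    unfolding simple_graph_def
  proof (intro conjI allI impI)
    show "finite ?V" using finV by simp
    fix x y assume "?E x y"
    then obtain u v where uv: "u \<in> {..<k} \<times> V" "v \<in> {..<k} \<times> V"
      "x = embed b L p u" "y = embed b L p v" "fst u = fst v" "sample_edge L p (snd u) (snd v)" by blast
    then have "snd u \<noteq> snd v" by (auto simp: sample_edge_def sample_arc_def)
    then show "x \<noteq> y" using uv by (auto simp: inj_eq[OF inj_embed])
    show "x \<in> ?V" "y \<in> ?V" using uv by auto
    show "?E y x" using uv unfolding sample_edge_def by metis
  qed
  show ?thesis
    unfolding semilinear_def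
  proof (intro conjI simple exI[of _ 9] exI[of _ fs] exI[of _ \<phi>] ballI impI)
    show "length x = 9" if "x \<in> ?V" for x using that length_embed by auto
    show "length fs = 10" by (simp add: fs_def)
    show "?E x y = \<phi> (sign_atoms 9 fs x y)" if "x \<in> ?V" "y \<in> ?V" for x y
      using edge that by blast
  qed simp
qed

subsection \<open>Disjoint copies and the choice of parameters\<close>

lemma of_nat_le_exp: "real m \<le> exp (real m)"
  using exp_ge_add_one_self[of "real m"] by linarith

lemma two_power_le_exp: "(2 :: real) ^ m \<le> exp (real m)"
proof -
  have "(2 :: real) ^ m \<le> exp 1 ^ m"
    using exp_ge_add_one_self[of 1] by (intro power_mono) auto
  then show ?thesis using exp_of_nat_mult[of m "1 :: real"] by simp
qed

text \<open>\<open>L\<close> is exponential in \<open>K\<close>, and \<open>b\<close> is polynomial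
  in \<open>L\<close> for fixed \<open>g\<close>, so \<open>b ^ L\<close> is doubly exponential in
  \<open>K\<close>. Inverting this bound later produces the iterated logarithm.\<close>

lemma sample_size_le:
  fixes K g :: nat
  assumes K: "0 < K" and g: "0 < g"
  defines "L \<equiv> K * 2 ^ (10 * K)"
  defines "b \<equiv> 8 * (g * L ^ (2 * g))"
  shows "real (L * b ^ L) \<le> exp (exp (real (49 + g) * real K))"
proof -
  have gK: "1 \<le> real g * real K" "real K \<le> real g * real K" "real g \<le> real g * real K"
    using K g by (simp_all flip: of_nat_mult)
  have "real L = real K * 2 ^ (10 * K)" by (simp add: L_def)
  also have "\<dots> \<le> exp (real K) * exp (real (10 * K))"
    by (intro mult_mono of_nat_le_exp two_power_le_exp) auto
  also have "\<dots> = exp (11 * real K)" by (simp flip: exp_add)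
  finally have L: "real L \<le> exp (11 * real K)" .
  have "real b = 2 ^ 3 * (real g * real L ^ (2 * g))" by (simp add: b_def)
  also have "\<dots> \<le> exp (real 3) * (exp (real g) * exp (11 * real K) ^ (2 * g))"
    by (intro mult_mono of_nat_le_exp two_power_le_exp power_mono L) auto
  also have "\<dots> = exp (3 + real g + 22 * (real g * real K))"
    by (simp add: exp_add exp_of_nat_mult[symmetric] algebra_simps)
  also have "\<dots> \<le> exp (26 * (real g * real K))"
    unfolding exp_le_cancel_iff using gK by linarith
  finally have b: "real b \<le> exp (26 * (real g * real K))" .
  have "real (L * b ^ L) \<le> exp (11 * real K) * exp (26 * (real g * real K)) ^ L"
    unfolding of_nat_mult of_nat_power by (intro mult_mono power_mono L b) auto
  also have "\<dots> = exp (11 * real K + 26 * (real g * real K) * real L)"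
    by (simp add: exp_add exp_of_nat_mult[symmetric] algebra_simps)
  also have "\<dots> \<le> exp (exp (real (49 + g) * real K))"
  proof (subst exp_le_cancel_iff)
    have "11 * real K \<le> 11 * (real g * real K) * exp (11 * real K)"
      using mult_mono[of "11 * real K" "11 * (real g * real K)" 1 "exp (11 * real K)"] gK by simp
    moreover have "26 * (real g * real K) * real L \<le> 26 * (real g * real K) * exp (11 * real K)"
      using L by (intro mult_left_mono) auto
    ultimately have "11 * real K + 26 * (real g * real K) * real L
        \<le> 37 * (real g * real K) * exp (11 * real K)" by (simp add: algebra_simps)
    also have "\<dots> = real 37 * (real g * real K) * exp (11 * real K)" by simp
    also have "\<dots> \<le> exp (real 37) * (exp (real g) * exp (real K)) * exp (11 * real K)"
      by (intro mult_mono of_nat_le_exp) auto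
    also have "\<dots> = exp (37 + real g + 12 * real K)" by (simp flip: exp_add)
    \<comment> \<open>The constant 49 is 37 + 12; \<open>37 \<le> 37 * K\<close> and
      \<open>g \<le> g * K\<close> since \<open>K\<close> is at least 1.\<close>
    also have "\<dots> \<le> exp (real (49 + g) * real K)"
    proof -
      have "real (49 + g) * real K = 49 * real K + real g * real K" by (simp add: algebra_simps)
      moreover have "1 \<le> real K" using K by simp
      ultimately show ?thesis unfolding exp_le_cancel_iff using gK by linarith
    qed
    finally show "11 * real K + 26 * (real g * real K) * real L \<le> exp (real (49 + g) * real K)" .
  qed
  finally show ?thesis .
qed

text \<open>An independent set splits into its traces on the copies, so the ratio between order and
  independence number survives for every \<open>k\<close>. The factor 2 is due to the deletion,
  which may remove half of the \<open>L * n\<close> vertices.\<close>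

lemma exists_semilinear_copies:
  fixes K g :: nat
  assumes K: "0 < K" and g: "0 < g"
  obtains N :: nat where "0 < N" "real N \<le> exp (exp (real (49 + g) * real K))"
    "\<And>k. \<exists>V E. semilinear 10 V E \<and> girth_ge V E g \<and> card V = k * N \<and>
       (\<forall>S. independent_set V E S \<longrightarrow> K * card S \<le> 2 * (k * N))"
proof -
  define L where "L = K * 2 ^ (10 * K)"
  define b where "b = 8 * (g * L ^ (2 * g))"
  define n where "n = g * L ^ (2 * g) * b ^ (L - 2)"
  obtain p where p: "p \<in> samples b L n" and half: "L * n \<le> 2 * card (kept b L n g p)"
    and ind: "\<And>S. S \<subseteq> {..<L} \<times> {..<n} \<Longrightarrow>
      (\<And>u v. u \<in> S \<Longrightarrow> v \<in> S \<Longrightarrow> \<not> sample_edge L p u v) \<Longrightarrow> K * card S \<le> L * n"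
    using exists_good_sample[OF K g] unfolding L_def b_def n_def by blast
  define W where "W = kept b L n g p"
  define N where "N = card W"
  have W: "W \<subseteq> {..<L} \<times> {..<n}" by (auto simp: W_def kept_def)
  have finW: "finite W" using W finite_subset by blast
  have L0: "0 < L" using K by (simp add: L_def)
  have b0: "0 < b" using g L0 by (simp add: b_def)
  have n0: "0 < n" using g L0 b0 by (simp add: n_def)
  have "0 < L * n" using L0 n0 by simp
  then have N0: "0 < N" using half unfolding N_def W_def by linarith
  have "N \<le> L * n" using card_mono[OF _ W] by (simp add: N_def)
  also have "n \<le> b ^ L"
  proof -
    have "1 < L"
    proof -
      have "(2::nat) ^ 1 \<le> 2 ^ (10 * K)" by (rule power_increasing) (use K in auto)
      also have "\<dots> \<le> L" using K by (simp add: L_def)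
      finally show ?thesis by simp
    qed
    then have "L = Suc (Suc (L - 2))" by simp
    then have pw: "b ^ L = b * (b * b ^ (L - 2))" by (metis power_Suc)
    have "n \<le> b * b ^ (L - 2)" unfolding n_def by (rule mult_right_mono) (simp_all add: b_def)
    also have "\<dots> \<le> b ^ L" unfolding pw using b0 by simp
    finally show ?thesis .
  qed
  finally have "N \<le> L * b ^ L" by simp
  then have "real N \<le> real (L * b ^ L)" by (rule of_nat_mono)
  also have "\<dots> \<le> exp (exp (real (49 + g) * real K))"
    unfolding L_def b_def by (rule sample_size_le[OF K g])
  finally have Nle: "real N \<le> exp (exp (real (49 + g) * real K))" .
  show ?thesis
  proof (rule that[OF N0 Nle])
    fix k
    let ?f = "embed b L p"
    let ?V = "?f ` ({..<k} \<times> W)"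
    let ?E = "\<lambda>x y. \<exists>u\<in>{..<k} \<times> W. \<exists>v\<in>{..<k} \<times> W. x = ?f u \<and> y = ?f v \<and>
      fst u = fst v \<and> sample_edge L p (snd u) (snd v)"
    have inj: "inj_on ?f ({..<k} \<times> W)" using inj_embed by (rule inj_on_subset) simp
    have "semilinear 10 ?V ?E" by (rule semilinear_embed[OF p W])
    moreover have "girth_ge ?V ?E g"
      by (rule girth_image[OF inj girth_copies[OF girth_kept[OF p, of g, folded W_def]]])
    moreover have "card ?V = k * N" using inj by (simp add: card_image card_cartesian_product N_def)
    moreover have "K * card S \<le> 2 * (k * N)" if S: "independent_set ?V ?E S" for S
    proof -
      define T where "T = (\<lambda>j. {v \<in> W. ?f (j, v) \<in> S})"
      have finT: "finite (T j)" for j using finW by (simp add: T_def)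
      have "S \<subseteq> (\<Union>j<k. (\<lambda>v. ?f (j, v)) ` T j)"
      proof
        fix x assume x: "x \<in> S"
        then have "x \<in> ?V" using S by (auto simp: independent_set_def)
        then obtain j v where "j < k" "v \<in> W" "x = ?f (j, v)" by (elim imageE SigmaE) auto
        then show "x \<in> (\<Union>j<k. (\<lambda>v. ?f (j, v)) ` T j)" using x by (auto simp: T_def)
      qed
      then have "card S \<le> card (\<Union>j<k. (\<lambda>v. ?f (j, v)) ` T j)"
        using finT by (intro card_mono) auto
      also have "\<dots> \<le> (\<Sum>j<k. card ((\<lambda>v. ?f (j, v)) ` T j))" by (rule card_UN_le) simp
      also have "\<dots> \<le> (\<Sum>j<k. card (T j))" by (intro sum_mono card_image_le finT)
      finally have "K * card S \<le> K * (\<Sum>j<k. card (T j))" by (rule mult_left_mono) simp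
      also have "\<dots> = (\<Sum>j<k. K * card (T j))" by (rule sum_distrib_left)
      also have "\<dots> \<le> (\<Sum>j<k. 2 * N)"
      proof (rule sum_mono)
        fix j assume j: "j \<in> {..<k}"
        have "K * card (T j) \<le> L * n"
        proof (rule ind)
          show "T j \<subseteq> {..<L} \<times> {..<n}" using W by (auto simp: T_def)
          fix u v assume u: "u \<in> T j" and v: "v \<in> T j"
          show "\<not> sample_edge L p u v"
          proof
            assume e: "sample_edge L p u v"
            have "?E (?f (j, u)) (?f (j, v))"
              by (rule bexI[of _ "(j, u)"], rule bexI[of _ "(j, v)"]) (use j u v e in \<open>simp_all add: T_def\<close>)
            moreover have "?f (j, u) \<in> S" "?f (j, v) \<in> S" using u v by (simp_all add: T_def)
            ultimately show False using S unfolding independent_set_def by blast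
          qed
        qed
        then show "K * card (T j) \<le> 2 * N" using half by (simp add: N_def W_def)
      qed
      finally show ?thesis by simp
    qed
    ultimately show "\<exists>V E. semilinear 10 V E \<and> girth_ge V E g \<and> card V = k * N \<and>
       (\<forall>S. independent_set V E S \<longrightarrow> K * card S \<le> 2 * (k * N))" by blast
  qed
qed

text \<open>This covers the small \<open>n\<close>, for which \<open>ln (ln n)\<close> is bounded in
  terms of \<open>g\<close>.\<close>

lemma edgeless_graph:
  "\<exists>(V :: real list set) E. semilinear t V E \<and> girth_ge V E g \<and> card V = m"
proof (intro exI conjI)
  let ?V = "(\<lambda>j. [real j]) ` {..<m}" and ?E = "\<lambda>(x :: real list) (y :: real list). False"
  have "simple_graph ?V ?E" by (simp add: simple_graph_def)
  moreover have "\<forall>x\<in>?V. length x = 1" by simp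
  moreover have "length (replicate t (coord_diff 0 0)) = t" by simp
  ultimately show "semilinear t ?V ?E"
    unfolding semilinear_def by (intro conjI exI[of _ 1] exI[of _ "replicate t (coord_diff 0 0)"]
      exI[of _ "\<lambda>_. False"]) simp_all
  show "girth_ge ?V ?E g"
    unfolding girth_ge_def is_cycle_def by (metis gr_zeroI not_numeral_le_zero)
  show "card ?V = m" by (subst card_image) (auto simp: inj_on_def)
qed

theorem theorem1p3:
  shows "\<exists>t::nat. t > 0 \<and>
    (\<forall>g::nat. g > 0 \<longrightarrow>
      (\<exists>c::real. c > 0 \<and>
        (\<forall>n::nat. n \<ge> 3 \<longrightarrow>
          (\<exists>(V :: real list set) E.
             semilinear t V E \<and> girth_ge V E g \<and>
             \<not> (\<exists>S. independent_set V E S \<and> card S = n) \<and>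
             real (card V) \<ge> c * real n * ln (ln (real n))))))"
proof (rule exI[of _ 10], intro conjI allI impI)
  fix g :: nat assume g: "g > 0"
  define C where "C = real (49 + g)"
  have C: "1 \<le> C" by (simp add: C_def)
  show "\<exists>c::real. c > 0 \<and> (\<forall>n::nat. n \<ge> 3 \<longrightarrow> (\<exists>(V :: real list set) E.
             semilinear 10 V E \<and> girth_ge V E g \<and>
             \<not> (\<exists>S. independent_set V E S \<and> card S = n) \<and>
             real (card V) \<ge> c * real n * ln (ln (real n))))"
  \<comment> \<open>Here 48 is 4 * 12: for large \<open>y\<close> the rounding in \<open>K\<close>
    gives \<open>y \<le> 4 * C * K\<close>, and the graph has at least \<open>n * K / 12\<close>
    vertices.\<close>
  proof (intro exI[of _ "1 / (48 * C)"] conjI allI impI)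
    show "0 < 1 / (48 * C)" using C by simp
    fix n :: nat assume n: "3 \<le> n"
    define y where "y = ln (ln (real n))"
    show "\<exists>(V :: real list set) E. semilinear 10 V E \<and> girth_ge V E g \<and>
             \<not> (\<exists>S. independent_set V E S \<and> card S = n) \<and>
             real (card V) \<ge> 1 / (48 * C) * real n * ln (ln (real n))"
    \<comment> \<open>Below this threshold the choice of \<open>K\<close> in the second case would
      be 0, and \<open>n - 1\<close> isolated vertices suffice.\<close>
    proof (cases "y < 2 * C")
      case True
      obtain V :: "real list set" and E where V: "semilinear 10 V E" "girth_ge V E g" "card V = n - 1"
        using edgeless_graph by blast
      have "finite V" using V(3) n card.infinite by fastforce
      then have "card S \<le> n - 1" if "independent_set V E S" for S
        using card_mono[of V S] that V(3) by (simp add: independent_set_def)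
      then have no: "\<not> (\<exists>S. independent_set V E S \<and> card S = n)" using n by fastforce
      have "real n * y \<le> real n * (2 * C)" using True by (intro mult_left_mono) auto
      then have "1 / (48 * C) * real n * y \<le> real n / 24" using C by (simp add: field_simps)
      moreover have "real (card V) = real n - 1" using n V(3) by (simp add: of_nat_diff)
      ultimately have "1 / (48 * C) * real n * y \<le> real (card V)" using n by linarith
      then show ?thesis using V no unfolding y_def by blast
    next
      case False
      \<comment> \<open>With this choice \<open>C * K \<le> y / 2\<close>, so a single copy has at
        most \<open>exp (exp (y / 2))\<close> vertices, far fewer than \<open>n\<close>.\<close>
      define K where "K = nat \<lfloor>y / (2 * C)\<rfloor>"
      have y1: "1 \<le> y / (2 * C)" using False C by simp
      then have K1: "1 \<le> real K" by (simp add: K_def le_floor_iff)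
      then have K: "0 < K" by linarith
      have Kle: "real K \<le> y / (2 * C)" and Kgt: "y / (2 * C) < real K + 1"
        using y1 unfolding K_def by linarith+
      have CK: "C * real K \<le> y / 2" using Kle C by (simp add: field_simps)
      have "y / (2 * C) \<le> 2 * real K" using Kgt K1 by linarith
      then have yK: "y \<le> 4 * C * real K" using C by (simp add: field_simps)
      obtain N where N: "0 < N" "real N \<le> exp (exp (C * real K))" and graph:
        "\<And>k. \<exists>V E. semilinear 10 V E \<and> girth_ge V E g \<and> card V = k * N \<and>
           (\<forall>S. independent_set V E S \<longrightarrow> K * card S \<le> 2 * (k * N))"
        using exists_semilinear_copies[OF K g] unfolding C_def by metis
      \<comment> \<open>\<open>z\<close> is the square root of \<open>ln n\<close>. From
        \<open>2 \<le> z\<close> follows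
        \<open>4 * exp z \<le> exp (2 * z) \<le> exp (z * z)\<close>, so a copy has at most
        \<open>n / 4\<close> vertices.\<close>
      define z where "z = exp (y / 2)"
      have z: "2 \<le> z"
      proof -
        have "1 \<le> y / 2" using False C by linarith
        then show ?thesis using exp_ge_add_one_self[of "y / 2"] unfolding z_def by linarith
      qed
      have "1 < real n" using n by simp
      then have "0 < ln (real n)" by simp
      then have "z * z = ln (real n)" by (simp add: z_def y_def flip: exp_add)
      then have nz: "real n = exp (z * z)" using \<open>1 < real n\<close> by simp
      have "4 \<le> exp (2 :: real)" using two_power_le_exp[of 2] by simp
      also have "\<dots> \<le> exp z" using z by simp
      finally have "4 \<le> exp z" .
      then have "4 * exp z \<le> exp z * exp z" by (rule mult_right_mono) simp
      also have "\<dots> = exp (2 * z)" by (simp flip: exp_add)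
      also have "\<dots> \<le> real n" unfolding nz using z by simp
      finally have "4 * exp z \<le> real n" .
      moreover have "real N \<le> exp z" 
        unfolding z_def by (rule order_trans[OF N(2)]) (use CK in simp)
      ultimately have N4: "4 * real N \<le> real n" by linarith
      \<comment> \<open>The largest number of copies for which the bound
        \<open>2 * (k * N) / K\<close> on independent sets is at most \<open>n - 1\<close>.\<close>
      define k where "k = (n - 1) * K div (2 * N)"
      have kle: "2 * (k * N) \<le> (n - 1) * K"
        using div_times_less_eq_dividend[of "(n - 1) * K" "2 * N"] by (simp add: k_def mult_ac)
      have kgt: "(n - 1) * K < 2 * (k * N) + 2 * N"
        using dividend_less_div_times[of "2 * N" "(n - 1) * K"] N(1) by (simp add: k_def mult_ac)
      obtain V E where V: "semilinear 10 V E" "girth_ge V E g" "card V = k * N"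
        and ind: "\<And>S. independent_set V E S \<Longrightarrow> K * card S \<le> 2 * (k * N)"
        using graph[of k] by blast
      have "card S \<noteq> n" if "independent_set V E S" for S
      proof
        assume "card S = n"
        then have "K * n \<le> 2 * (k * N)" using ind[OF that] by simp
        also have "\<dots> \<le> K * (n - 1)" using kle by (simp only: mult.commute[of K])
        finally show False using K n by simp
      qed
      moreover have "1 / (48 * C) * real n * y \<le> real (card V)"
      proof -
        \<comment> \<open>As \<open>n - 1\<close> is at least \<open>2 * n / 3\<close>, the number
          of vertices is at least \<open>n * K / 3 - N\<close>. The rounding loss \<open>N\<close>
          is at most \<open>n / 4\<close>, hence at most \<open>n * K / 4\<close>, and 1/3 - 1/4 =
          1/12.\<close>
        have "real n * y \<le> real n * (4 * C * real K)" using yK by (intro mult_left_mono) auto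
        then have "1 / (48 * C) * real n * y \<le> real n * real K / 12" using C by (simp add: field_simps)
        moreover have "real ((n - 1) * K) \<le> 2 * real (k * N) + 2 * real N"
          using kgt by linarith
        moreover have "2 / 3 * real n * real K \<le> real ((n - 1) * K)"
          using n K by (simp add: of_nat_diff)
        moreover have "real n * 1 \<le> real n * real K" using K1 by (intro mult_left_mono) auto
        ultimately show ?thesis using N4 V(3) by linarith
      qed
      ultimately show ?thesis using V unfolding y_def by blast
    qed
  qed
qed simp

end
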